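(* (i) For every real $q$ with $0<q<1$, $$\frac{(q^{5/3};q)_\infty^2\,(q^{7/6};q)_\infty^2}{(q^2;q)_\infty^2\,(q^{3/2};q)_\infty(q^{1/6};q)_\infty} =\sum_{n=0}^{\infty}(-1)^n\frac{(q^{2/3},q^{5/6},q^{7/6};q^{1/2})_n\,(q^{-1/6};q)_n(q^{2/3};q)_n}{(q;q)_n(q^2;q)_n\,(q^{3/2};q^{1/2})_{3n}\,(1+q^{1/3})}\,q^{\frac{n(9n+11)}{12}}$$ $$\times\left\{(1+q^{\frac n2+\frac16})(1+q^{\frac n2+\frac13})(1+q^{\frac n2+\frac12})(1+q^{n+\frac13})-q^{\frac{n+1}2}(1+q^{\frac32n+\frac13})\right\}.$$ (ii) The limiting case $q\to1$ gives $$\frac{81\sqrt3}{28\cdot2^{2/3}\,\pi}=\sum_{n=0}^{\infty}\left(\frac{-1}{27}\right)^n\frac{(\frac23)_n(\frac73)_n(-\frac16)_n}{(1)_n(1)_n(2)_n}.$$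
   Context: For a base $p$: $(x;p)_0=1$, $(x;p)_n=\prod_{j=0}^{n-1}(1-p^jx)$, $(x;p)_\infty=\prod_{j\ge0}(1-p^jx)$, and $(x_1,\dots,x_r;p)_n=(x_1;p)_n\cdots(x_r;p)_n$. Fractional powers of $q$ are the positive real ones. $(x)_0=1$ and $(x)_n=x(x+1)\cdots(x+n-1)$ is the ordinary shifted factorial. *)

theory Defs
  imports "HOL-Analysis.Analysis"
begin

definition qpoch :: "real \<Rightarrow> real \<Rightarrow> nat \<Rightarrow> real" where
  "qpoch x p n = (\<Prod>j<n. 1 - p ^ j * x)"

(* prodinf carries its usual meaning only where the product converges, in particular for |p| < 1 *)
definition qpoch_inf :: "real \<Rightarrow> real \<Rightarrow> real" where
  "qpoch_inf x p = (\<Prod>j. 1 - p ^ j * x)"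

end

(*
  Write p = q^(1/2). The nonterminating quadratic series of Gasper and Rahman,
    S(a) = sum_k (1 - a p^(3k)) (a, b, p/b; p)_k (e; p^2)_k (a/e)^k p^(k(k+1)/2)
                 / ((p^2, a p^2/b, a b p; p^2)_k (a p/e; p)_k),
  satisfies a first order recurrence under a -> a p^2, certified by a telescoping companion, and S(a) -> 1 as a -> 0;
  hence S(a) is an infinite product. A second telescoping certificate relates e to e/p^2; applying it while moving the
  first summation index along gives a faster series with the same sum. For a = e = q^(7/6), b = q^(1/3) the accelerated
  terms are, up to a constant factor, those of (i). For (ii) let q -> 1: the ratios of consecutive core terms are at most
  1/2 in absolute value from n = 1 on, and the logarithms of the factors of the product are O(1/(j+1)^2), uniformly in q,
  so Tannery's theorem applies to both sides; the limit product is a quotient of Gamma values.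
*)
theory Submission
  imports Defs
begin

section \<open>Shifted factorials\<close>

text \<open>The two-index summand used below is, formally, the term of index k = n + m of the
  quadratic series for e_n = e / p^(2n), rescaled so that every n gives the same sum over all k.
  Three effects fix its shape. The quotient of the two closed forms is (a p^2/(b e), a b p/e; p^2)_n
  / (a p/e; p)_(2n). Reversing the first n factors of (e_n; p^2)_k gives (-e)^n p^(-n(n+1)) (p^2/e;
  p^2)_n and leaves (e; p^2)_m. Finally (a p/e; p)_(2n) and (a p/e_n; p)_k join to (a p/e;
  p)_(3n+m), which is the origin of the factorial of length 3n in (i).

  Since all these series agree, consecutive ones can differ termwise by a difference in m; starting
  the index at n leaves a remainder of order p^n and one boundary term for each n.

  Two features of the specialization shape the estimates: a = e makes (a/e)^k = 1, so all decay has
  to come from the powers of p; and p^2/e = q^(-1/6) exceeds 1, so that one factor escapes the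
  bounds valid for parameters in the unit interval.\<close>

lemma qpoch_0 [simp]: "qpoch x p 0 = 1"
  by (simp add: qpoch_def)

lemma qpoch_Suc: "qpoch x p (Suc n) = qpoch x p n * (1 - p ^ n * x)"
  by (simp add: qpoch_def)

lemma qpoch_factor_pos:
  assumes "0 \<le> p" "p \<le> 1" "0 \<le> x" "x < 1"
  shows "0 < 1 - p ^ n * (x::real)"
proof -
  have "p ^ n * x \<le> 1 * x" using assms by (intro mult_right_mono power_le_one) auto
  then show ?thesis using assms by simp
qed

lemma qpoch_pos:
  assumes "0 \<le> p" "p \<le> 1" "0 \<le> x" "x < 1"
  shows "0 < qpoch x p n"
  unfolding qpoch_def using qpoch_factor_pos[OF assms] by (intro prod_pos) auto

lemma qpoch_le_1:
  assumes "0 \<le> p" "p \<le> 1" "0 \<le> x" "x < 1"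
  shows "qpoch x p n \<le> 1"
  unfolding qpoch_def using qpoch_factor_pos[OF assms] assms
  by (intro prod_le_1) (auto intro: less_imp_le)

lemma qpoch_antimono:
  assumes "0 \<le> p" "p \<le> 1" "0 \<le> y" "y \<le> x" "x < 1"
  shows "qpoch x p n \<le> qpoch y p n"
  unfolding qpoch_def
proof (rule prod_mono, safe)
  fix j
  show "0 \<le> 1 - p ^ j * x" using qpoch_factor_pos[of p x j] assms by simp
  show "1 - p ^ j * x \<le> 1 - p ^ j * y" using assms by (simp add: mult_left_mono)
qed

lemma convergent_prod_qpoch:
  assumes "0 \<le> p" "p < 1"
  shows "convergent_prod (\<lambda>j. 1 - p ^ j * (x::real))"
proof -
  have "summable (\<lambda>j. norm (p ^ j * x))"
    using assms by (simp add: abs_mult power_abs summable_mult2)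
  then have "summable (\<lambda>j. norm ((1 - p ^ j * x) - 1))" by simp
  then show ?thesis
    by (intro abs_convergent_prod_imp_convergent_prod summable_imp_abs_convergent_prod)
qed

lemma qpoch_LIMSEQ:
  assumes "0 \<le> p" "p < 1"
  shows "qpoch x p \<longlonglongrightarrow> qpoch_inf x p"
proof -
  have "(\<lambda>n. \<Prod>j\<le>n. 1 - p ^ j * x) \<longlonglongrightarrow> qpoch_inf x p"
    unfolding qpoch_inf_def by (intro convergent_prod_LIMSEQ convergent_prod_qpoch assms)
  then have "(\<lambda>n. qpoch x p (Suc n)) \<longlonglongrightarrow> qpoch_inf x p"
    by (simp add: qpoch_def lessThan_Suc_atMost)
  then show ?thesis by (rule LIMSEQ_imp_Suc)
qed

lemma qpoch_inf_pos:
  assumes "0 \<le> p" "p < 1" "0 \<le> x" "x < 1"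
  shows "0 < qpoch_inf x p"
  unfolding qpoch_inf_def
  using convergent_prod_qpoch[of p x] qpoch_factor_pos[of p x] assms
  by (intro less_0_prodinf) auto

lemma qpoch_inf_le:
  assumes "0 \<le> p" "p < 1" "0 \<le> x" "x < 1"
  shows "qpoch_inf x p \<le> qpoch x p n"
proof (rule LIMSEQ_le_const2[OF qpoch_LIMSEQ])
  show "\<exists>N. \<forall>m\<ge>N. qpoch x p m \<le> qpoch x p n"
  proof (intro exI allI impI)
    fix m assume "n \<le> m"
    then show "qpoch x p m \<le> qpoch x p n"
    proof (induction m rule: dec_induct)
      case (step m)
      have "qpoch x p m * (1 - p ^ m * x) \<le> qpoch x p m * 1"
        using assms qpoch_pos[of p x m] by (intro mult_left_mono) auto
      with step show ?case by (simp add: qpoch_Suc)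
    qed simp
  qed
qed (use assms in auto)

text \<open>Both sides are the product of the factors with exponents 0 to n. Later this moves a
  parameter by one power of the base at the cost of a rational factor.\<close>

lemma qpoch_shift:
  "qpoch x p n * (1 - p ^ n * x) = (1 - x) * qpoch (p * x) p n"
  by (induction n) (simp_all add: qpoch_Suc mult_ac)

lemma qpoch_inf_shift:
  assumes "0 \<le> r" "r < 1"
  shows "qpoch_inf x r = (1 - x) * qpoch_inf (r * x) r"
proof (rule LIMSEQ_unique)
  have "(\<lambda>n. qpoch x r n * (1 - r ^ n * x)) \<longlonglongrightarrow> qpoch_inf x r * (1 - 0 * x)"
    using assms by (intro tendsto_intros qpoch_LIMSEQ LIMSEQ_power_zero) simp_all
  then show "(\<lambda>n. qpoch x r n * (1 - r ^ n * x)) \<longlonglongrightarrow> qpoch_inf x r" by simp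
  show "(\<lambda>n. qpoch x r n * (1 - r ^ n * x)) \<longlonglongrightarrow> (1 - x) * qpoch_inf (r * x) r"
    unfolding qpoch_shift using assms by (intro tendsto_intros qpoch_LIMSEQ)
qed

section \<open>The quadratic series and its acceleration\<close>

text \<open>
  The summand is stored without its very-well-poised factor \<open>1 - a * p ^ (3 * (n + m))\<close>, so that both
  certificates are short rational multiples of it. For \<open>n = 0\<close> it belongs to the quadratic series summed over
  \<open>m\<close>; passing from \<open>n\<close> to \<open>n + 1\<close> replaces \<open>e\<close> by \<open>e / p\<^sup>2\<close> and lets the index
  \<open>k = n + m\<close> start one later.
\<close>

definition qsummand :: "real \<Rightarrow> real \<Rightarrow> real \<Rightarrow> real \<Rightarrow> nat \<Rightarrow> nat \<Rightarrow> real" where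
  "qsummand p b e a n m =
     qpoch a p (n + m) * qpoch b p (n + m) * qpoch (p / b) p (n + m)
     * (qpoch (a * p^2 / (b * e)) (p^2) n * qpoch (a * b * p / e) (p^2) n * qpoch (p^2 / e) (p^2) n
        * qpoch e (p^2) m)
     / (qpoch (p^2) (p^2) (n + m) * qpoch (a * p^2 / b) (p^2) (n + m) * qpoch (a * b * p) (p^2) (n + m)
        * qpoch (a * p / e) p (3 * n + m))
     * ((-a) ^ n * (a / e) ^ m * p ^ (n * (n - 1) + 2 * n * m + \<Sum>{..n + m}))"

definition qF :: "real \<Rightarrow> real \<Rightarrow> real \<Rightarrow> real \<Rightarrow> nat \<Rightarrow> nat \<Rightarrow> real" where
  "qF p b e a n m = (1 - a * p ^ (3 * (n + m))) * qsummand p b e a n m"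

text \<open>The companion that closes the telescoping in \<open>m\<close>. Its two denominators are
  the next two factors of \<open>qpoch (a * p / e) p (3 * n + m)\<close>, two of the three that
  raising \<open>n\<close> brings in.\<close>

definition qG :: "real \<Rightarrow> real \<Rightarrow> real \<Rightarrow> real \<Rightarrow> nat \<Rightarrow> nat \<Rightarrow> real" where
  "qG p b e a n m =
     - (qsummand p b e a n m * (1 - a * p ^ (n + m)) * (1 - b * p ^ (n + m)) * (1 - p ^ (n + m + 1) / b)
        * (a / e) * p ^ (3 * n + m + 1)
        / ((1 - a / e * p ^ (3 * n + m + 1)) * (1 - a / e * p ^ (3 * n + m + 2))))"

locale qparam =
  fixes p b e :: real
  assumes p: "0 < p" "p < 1" and b: "p < b" "b < 1" and e: "0 < e" "e < 1"
begin

text \<open>Common part of the ratios for the steps in \<open>m\<close> and in \<open>n\<close>: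
  both raise \<open>n + m\<close> by one and append the same next factor to the factorial of length
  \<open>3 * n + m\<close>. Dividing it out leaves a short polynomial identity.\<close>

abbreviation "kap a n m \<equiv> (1 - a * p^(n+m)) * (1 - b * p^(n+m)) * (1 - p * p^(n+m) / b) * (p ^ (3 * n + m + 1) * a)
   / ((1 - p^2 * (p^(n+m))^2) * (1 - a * p^2 / b * (p^(n+m))^2) * (1 - a * b * p * (p^(n+m))^2)
      * (1 - a / e * p ^ (3 * n + m + 1)))"

lemma power_square: "(p\<^sup>2) ^ n = (p ^ n)\<^sup>2"
  by (simp flip: power_mult add: mult.commute)

lemma qsummand_Suc_right:
  "qsummand p b e a n (Suc m) = qsummand p b e a n m * (kap a n m * (1 - e * (p ^ m)^2) / e)"
proof -
  have E: "n * (n - 1) + 2 * n * Suc m + \<Sum>{..n + Suc m} 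
     = (n * (n - 1) + 2 * n * m + \<Sum>{..n + m}) + (3 * n + m + 1)" by simp
  show ?thesis unfolding qsummand_def E power_add[of p _ "3 * n + m + 1"]
    by (simp add: qpoch_Suc power_square mult_ac)
qed

lemma qsummand_Suc_left:
  "qsummand p b e a (Suc n) m = qsummand p b e a n m * 
    (- kap a n m * (1 - a * p^2 / (b * e) * (p ^ n)^2) * (1 - a * b * p / e * (p ^ n)^2) * (1 - p^2 / e * (p^n)^2)
      * (p ^ m)^2 / ((1 - a / e * p ^ (3 * n + m + 2)) * (1 - a / e * p ^ (3 * n + m + 3))))"
proof -
  have E: "Suc n * (Suc n - 1) + 2 * Suc n * m + \<Sum>{..Suc n + m} 
     = (n * (n - 1) + 2 * n * m + \<Sum>{..n + m}) + (3 * n + m + 1) + m * 2"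
    by (cases n) (simp_all add: algebra_simps)
  have E3: "3 * Suc n + m = Suc (Suc (Suc (3 * n + m)))" by simp
  show ?thesis unfolding qsummand_def E E3 power_add[of p _ "m * 2"] power_add[of p _ "3 * n + m + 1"]
    by (simp add: qpoch_Suc power_square mult_ac numeral_3_eq_3 flip: power_mult)
qed


text \<open>What is left of \<open>qF_qG_pair\<close> for x = p^n, y = p^m, z = p^(n+m) once the
  common factor is removed and denominators are cleared. The inverses of \<open>b\<close> and
  \<open>e\<close> become variables tied by B b = 1 and E e = 1, so that \<open>algebra\<close>
  meets polynomials only.\<close>

lemma wz_poly_acceleration:
  fixes a x y :: real
  defines "z \<equiv> x * y" 
  shows "(1 - a * p^3 * z^3) * ((1 - e * y^2) * (1 - a / e * p^2 * x^3 * y) * (1 - a / e * p^3 * x^3 * y)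
    + e * (1 - a * p^2 / (b * e) * x^2) * (1 - a * b * p / e * x^2) * (1 - p^2 / e * x^2) * y^2)
   = (1 - p^2 * z^2) * (1 - a * p^2 / b * z^2) * (1 - a * b * p * z^2) * (1 - a / e * p^3 * x^3 * y)
     - (1 - e * y^2) * (1 - a * p * z) * (1 - b * p * z) * (1 - p^2 * z / b) * (a / e * p^2 * x^3 * y)"
proof -
  obtain B where B: "B * b = 1" "\<And>t. t / b = t * B" using p b by (metis less_irrefl less_trans nonzero_eq_divide_eq times_divide_eq_right mult.right_neutral)
  obtain E where E: "E * e = 1" "\<And>t. t / e = t * E" using e by (metis less_irrefl nonzero_eq_divide_eq times_divide_eq_right mult.right_neutral)
  have BE: "t / (b * e) = t * B * E" for t using B(2) E(2) by (metis divide_divide_eq_left)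
  show ?thesis unfolding BE B(2) E(2) z_def using B(1) E(1) by algebra
qed

text \<open>The corresponding core of \<open>qF_qV_pair\<close>, with z = p^k.\<close>

lemma wz_poly_parameter:
  fixes a z :: real
  shows "(1 - a * z^3) * (1 - a * p^2 / b * z^2) * (1 - a * b * p * z^2) * (1 - a * p * z / e) * (1 - a * p^2 * z / e)
     - (1 - a * p^2 * z^3) * (1 - a * z) * (1 - a * p * z) * (1 - a * p^2 / (b * e)) * (1 - a * b * p / e) * z^2
   = (1 - z^2) * (1 - a^2 * p * z^2 / e) * (1 - a * p^2 / b * z^2) * (1 - a * b * p * z^2) * (1 - a * p^2 * z / e)
     - (1 - a^2 * p^3 * z^2 / e) * (1 - a * z) * (1 - b * z) * (1 - p * z / b) * (1 - e * z^2) * (a * p * z / e)"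
proof -
  obtain B where B: "B * b = 1" "\<And>t. t / b = t * B" using p b by (metis less_irrefl less_trans nonzero_eq_divide_eq times_divide_eq_right mult.right_neutral)
  obtain E where E: "E * e = 1" "\<And>t. t / e = t * E" using e by (metis less_irrefl nonzero_eq_divide_eq times_divide_eq_right mult.right_neutral)
  have BE: "t / (b * e) = t * B * E" for t using B(2) E(2) by (metis divide_divide_eq_left)
  show ?thesis unfolding BE B(2) E(2) using B(1) E(1) by algebra
qed


section \<open>Estimates uniform in a\<close>

lemma b_pos: "0 < b" using p b by simp

text \<open>Each parameter bounded by \<open>p\<close> is \<open>p\<close> times two numbers of the
  unit interval, thanks to \<open>p < b\<close>, \<open>b < 1\<close> and \<open>a \<le> e\<close>.
  Staying in (0, p] lets infinite products at \<open>p\<close> bound the denominators below,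
  independently of \<open>a\<close>.\<close>

lemma parameter_bounds:
  assumes "0 < a" "a \<le> e"
  shows "0 < a * p^2 / b" "a * p^2 / b \<le> p" "0 < a * b * p" "a * b * p \<le> p"
    "0 < a * p / e" "a * p / e \<le> p" "0 < a * p^2 / e" "a * p^2 / e \<le> p"
    "0 < a * p^2 / (b * e)" "a * p^2 / (b * e) \<le> p" "0 < a * b * p / e" "a * b * p / e \<le> p"
    "0 < a" "a < 1" "0 < a / e" "a / e \<le> 1"
proof -
  have pos: "0 < a / e" "0 < p / b" "0 < p" "0 < b" "0 < a" "0 < e" using assms e p b_pos by simp_all
  have one: "p / b \<le> 1" "a / e \<le> 1" "p \<le> 1" "b \<le> 1" "a \<le> 1" using p b e assms b_pos by simp_all
  show "0 < a * p^2 / b" "0 < a * b * p" "0 < a * p / e" "0 < a * p^2 / e" "0 < a * p^2 / (b * e)"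
    "0 < a * b * p / e" "0 < a" "a < 1" "0 < a / e" "a / e \<le> 1"
    using pos one assms e by simp_all
  have le: "t \<le> p" if "t = x * y * p" "0 \<le> x" "x \<le> 1" "0 \<le> y" "y \<le> 1" for t x y
    unfolding that(1) using mult_le_one[OF that(3-5)] pos(3) by simp
  show "a * p^2 / b \<le> p" by (rule le[of _ a "p / b"]) (use pos one in \<open>simp_all add: power2_eq_square\<close>)
  show "a * b * p \<le> p" by (rule le[of _ a b]) (use pos one in simp_all)
  show "a * p / e \<le> p" by (rule le[of _ "a / e" 1]) (use pos one in simp_all)
  show "a * p^2 / e \<le> p" by (rule le[of _ "a / e" p]) (use pos one in \<open>simp_all add: power2_eq_square\<close>)
  show "a * p^2 / (b * e) \<le> p" by (rule le[of _ "a / e" "p / b"]) (use pos one in \<open>simp_all add: power2_eq_square mult_ac\<close>)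
  show "a * b * p / e \<le> p" by (rule le[of _ "a / e" b]) (use pos one in simp_all)
qed

text \<open>\<open>K\<close> is chosen before \<open>a\<close>; this uniformity is what
  \<open>qS_near_0\<close> needs. The power of \<open>p\<close> supplies the decay even when
  \<open>a = e\<close>.\<close>

lemma qsummand_bound:
  "\<exists>K\<ge>0. \<forall>a n m. 0 < a \<longrightarrow> a \<le> e \<longrightarrow> \<bar>qsummand p b e a n m\<bar> \<le> K * (a / e) ^ m * p ^ (n + m)"
proof -
  define c where "c = qpoch_inf (p^2) (p^2) * qpoch_inf p (p^2) * qpoch_inf p (p^2) * qpoch_inf p p"
  have p2: "0 < p^2" "p^2 < 1" using p by (auto simp: power_less_one_iff)
  have c: "0 < c" unfolding c_def using p p2 by (intro mult_pos_pos qpoch_inf_pos) auto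
  have "Bseq (qpoch (p^2 / e) (p^2))" using p2 by (intro convergent_imp_Bseq convergentI[OF qpoch_LIMSEQ]) auto
  then obtain L where L: "0 < L" "\<And>n. \<bar>qpoch (p^2 / e) (p^2) n\<bar> \<le> L" by (auto elim: BseqE)
  have unit: "\<bar>qpoch x r n\<bar> \<le> 1" if "0 < x" "x < 1" "0 < r" "r < 1" for x r n
    using qpoch_pos[of r x n] qpoch_le_1[of r x n] that by simp
  show ?thesis
  proof (intro exI[of _ "L / c"] conjI allI impI)
    fix a n m assume a: "0 < a" "a \<le> e"
    note B = parameter_bounds[OF a]
    have den_ge: "qpoch_inf p r \<le> qpoch x r k" if "0 < x" "x \<le> p" "0 < r" "r < 1" for x r k
      using qpoch_inf_le[of r p k] qpoch_antimono[of r x p k] that p by linarith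
    define D where "D = qpoch (p^2) (p^2) (n + m) * qpoch (a * p^2 / b) (p^2) (n + m) * qpoch (a * b * p) (p^2) (n + m)
        * qpoch (a * p / e) p (3 * n + m)"
    have D: "c \<le> D"
    proof -
      have pos: "0 < qpoch_inf (p^2) (p^2)" "0 < qpoch_inf p (p^2)" "0 < qpoch_inf p p"
        using p p2 by (simp_all add: qpoch_inf_pos)
      have le: "qpoch_inf (p^2) (p^2) \<le> qpoch (p^2) (p^2) (n + m)"
        "qpoch_inf p (p^2) \<le> qpoch (a * p^2 / b) (p^2) (n + m)"
        "qpoch_inf p (p^2) \<le> qpoch (a * b * p) (p^2) (n + m)"
        "qpoch_inf p p \<le> qpoch (a * p / e) p (3 * n + m)"
        using qpoch_inf_le[of "p^2" "p^2" "n + m"] p2 B p by (simp_all add: den_ge)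
      show ?thesis unfolding c_def D_def
        by (intro mult_mono mult_nonneg_nonneg; use pos le in linarith)
    qed
    define N where "N = qpoch a p (n + m) * qpoch b p (n + m) * qpoch (p / b) p (n + m)
     * (qpoch (a * p^2 / (b * e)) (p^2) n * qpoch (a * b * p / e) (p^2) n * qpoch (p^2 / e) (p^2) n
        * qpoch e (p^2) m)"
    have "\<bar>N\<bar> \<le> 1 * 1 * 1 * (1 * 1 * L * 1)"
    proof -
      have lt: "a * p^2 / (b * e) < 1" "a * b * p / e < 1" "p / b < 1" "0 < p / b"
        using B p b b_pos by (auto intro: le_less_trans)
      show ?thesis unfolding N_def abs_mult
        by (intro mult_mono unit L(2) lt B mult_nonneg_nonneg abs_ge_zero; use p p2 b b_pos e L(1) in simp)
    qed
    then have N: "\<bar>N\<bar> \<le> L" by simp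
    define W where "W = (-a) ^ n * (a / e) ^ m * p ^ (n * (n - 1) + 2 * n * m + \<Sum>{..n + m})"
    \<comment> \<open>Of the quadratic exponent only the last summand of the triangular part is
      kept: geometric decay suffices.\<close>
    have "n + m \<le> \<Sum>{..n + m}" by (rule member_le_sum) auto
    then have "p ^ (n * (n - 1) + 2 * n * m + \<Sum>{..n + m}) \<le> p ^ (n + m)"
      using p by (intro power_decreasing) auto
    then have "\<bar>W\<bar> \<le> 1 * (a / e) ^ m * p ^ (n + m)" unfolding W_def abs_mult
      using a B p e by (intro mult_mono) (auto simp: power_abs abs_mult power_le_one)
    then have W: "\<bar>W\<bar> \<le> (a / e) ^ m * p ^ (n + m)" by simp
    have "\<bar>qsummand p b e a n m\<bar> = \<bar>N\<bar> / D * \<bar>W\<bar>"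
      unfolding qsummand_def D_def[symmetric] N_def[symmetric] W_def[symmetric]
      using D c by (simp add: abs_mult)
    also have "\<dots> \<le> L / c * ((a / e) ^ m * p ^ (n + m))"
      using N D c W L by (intro mult_mono frac_le) auto
    finally show "\<bar>qsummand p b e a n m\<bar> \<le> L / c * (a / e) ^ m * p ^ (n + m)" by (simp add: mult_ac)
  qed (use L c in simp)
qed

lemma qF_bound:
  assumes "0 < a" "a \<le> e" "\<bar>qsummand p b e a n m\<bar> \<le> C"
  shows "\<bar>qF p b e a n m\<bar> \<le> C"
proof -
  have "\<bar>1 - a * p ^ (3 * (n + m))\<bar> \<le> 1"
    using qpoch_factor_pos[of p a "3 * (n + m)"] parameter_bounds[OF assms(1,2)] p by (simp add: mult.commute)
  then have "\<bar>qF p b e a n m\<bar> \<le> 1 * C" unfolding qF_def abs_mult using assms by (intro mult_mono) auto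
  then show ?thesis by simp
qed

lemma qF_summable:
  assumes "0 < a" "a \<le> e"
  shows "summable (qF p b e a n)"
proof -
  obtain K where K: "0 \<le> K"
    "\<forall>a n m. 0 < a \<longrightarrow> a \<le> e \<longrightarrow> \<bar>qsummand p b e a n m\<bar> \<le> K * (a / e) ^ m * p ^ (n + m)"
    using qsummand_bound by blast
  have le: "\<bar>qF p b e a n m\<bar> \<le> K * p ^ n * p ^ m" for m
  proof (rule qF_bound[OF assms order.trans[OF K(2)[rule_format, OF assms]]])
    have "(a / e) ^ m \<le> 1" using parameter_bounds(15,16)[OF assms] by (intro power_le_one) simp_all
    then have "K * p ^ n * p ^ m * (a / e) ^ m \<le> K * p ^ n * p ^ m * 1"
      by (rule mult_left_mono) (use K(1) p in simp)
    then show "K * (a / e) ^ m * p ^ (n + m) \<le> K * p ^ n * p ^ m"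
      by (simp only: power_add mult_ac mult_1_left)
  qed
  show ?thesis
  proof (rule summable_comparison_test'[of "\<lambda>m. K * p ^ n * p ^ m" 0])
    show "summable (\<lambda>m. K * p ^ n * p ^ m)" using p by (intro summable_mult summable_geometric) simp
    show "norm (qF p b e a n m) \<le> K * p ^ n * p ^ m" for m using le by simp
  qed
qed

text \<open>Both terms on the left have index n + m + 1 in the underlying series. The series for
  \<open>n\<close> without its first term is thus compared with the series for \<open>Suc n\<close>,
  whose index starts one later.\<close>

lemma qF_qG_pair:
  assumes "0 < a" "a \<le> e"
  shows "qF p b e a n (Suc m) - qF p b e a (Suc n) m = qG p b e a n (Suc m) - qG p b e a n m"
proof -
  define x y h where "x = p ^ n" and "y = p ^ m" and "h = qsummand p b e a n m"
  define z where "z = x * y"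
  note B = parameter_bounds[OF assms]
  have pw: "p ^ (n + m) = z" "p ^ (3 * n + m) = x^3 * y" "p ^ n = x" "p ^ m = y"
     "p ^ (3 * n + m + 1) = p * x^3 * y" "p ^ (3 * n + m + 2) = p^2 * x^3 * y" "p ^ (3 * n + m + 3) = p^3 * x^3 * y"
  proof -
    have "p ^ (3 * n) = x ^ 3" by (simp add: x_def mult.commute flip: power_mult)
    then show "p ^ (n + m) = z" "p ^ (3 * n + m) = x^3 * y" "p ^ n = x" "p ^ m = y"
     "p ^ (3 * n + m + 1) = p * x^3 * y" "p ^ (3 * n + m + 2) = p^2 * x^3 * y" "p ^ (3 * n + m + 3) = p^3 * x^3 * y"
      by (simp_all add: x_def y_def z_def power_add power2_eq_square)
  qed
  have fpos: "0 < 1 - a / e * p ^ j" if "j \<ge> 1" for j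
    using qpoch_factor_pos[of p "a * p / e" "j - 1"] B p that by (cases j) (simp_all add: mult_ac)
  define D1 D2 D3 where "D1 = 1 - a / e * p * x^3 * y" and "D2 = 1 - a / e * p^2 * x^3 * y" and "D3 = 1 - a / e * p^3 * x^3 * y"
  have D: "D1 > 0" "D2 > 0" "D3 > 0"
    using fpos[of "3*n+m+1", unfolded pw] fpos[of "3*n+m+2", unfolded pw] fpos[of "3*n+m+3", unfolded pw]
    unfolding D1_def D2_def D3_def by (simp_all add: mult.assoc)
  define A1 A2 A3 where "A1 = 1 - p^2 * z^2" and "A2 = 1 - a * p^2 / b * z^2" and "A3 = 1 - a * b * p * z^2"
  have p2: "0 < p^2" "p^2 < 1" using p by (auto simp: power_less_one_iff)
  have z2: "z^2 = (p^2) ^ (n + m)" unfolding pw(1)[symmetric] by (simp flip: power_mult add: mult.commute)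
  have A: "A1 > 0" "A2 > 0" "A3 > 0" unfolding A1_def A2_def A3_def z2
    using qpoch_factor_pos[of "p^2" "p^2" "n+m"] qpoch_factor_pos[of "p^2" "a*p^2/b" "n+m"]
      qpoch_factor_pos[of "p^2" "a*b*p" "n+m"] p p2 B by (simp_all add: mult_ac)
  have nz: "A1 \<noteq> 0" "A2 \<noteq> 0" "A3 \<noteq> 0" "D1 \<noteq> 0" "D2 \<noteq> 0" "D3 \<noteq> 0" "e \<noteq> 0"
    using A D e by simp_all
  define k where "k = (1 - a * z) * (1 - b * z) * (1 - p * z / b) * (p * x^3 * y * a) / (A1 * A2 * A3 * D1)"
  have hr: "qsummand p b e a n (Suc m) = h * (k * (1 - e * y^2) / e)"
    unfolding qsummand_Suc_right h_def[symmetric] pw k_def A1_def A2_def A3_def D1_def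
    by (simp only: mult.assoc)
  have hl: "qsummand p b e a (Suc n) m = h * (- k * (1 - a * p^2 / (b * e) * x^2) * (1 - a * b * p / e * x^2) * (1 - p^2 / e * x^2)
      * y^2 / (D2 * D3))"
    unfolding qsummand_Suc_left h_def[symmetric] pw k_def A1_def A2_def A3_def D1_def D2_def D3_def
    by (simp only: mult.assoc)
  define M where "M = (1 - a * p^2 / (b * e) * x^2) * (1 - a * b * p / e * x^2) * (1 - p^2 / e * x^2)"
  define W where "W = 1 - a * p^3 * z^3"
  define Q where "Q = (1 - a * p * z) * (1 - b * p * z) * (1 - p^2 * z / b) * (a / e * p^2 * x^3 * y)"
  have Weq: "W = 1 - a * p ^ (3 * (n + Suc m))" "W = 1 - a * p ^ (3 * (Suc n + m))"
  proof -
    have "p ^ (3 * (n + Suc m)) = p^3 * z^3" "p ^ (3 * (Suc n + m)) = p^3 * z^3"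
      unfolding pw(1)[symmetric] power_mult_distrib[symmetric] power_Suc[symmetric] power_mult[symmetric] power_add[symmetric] by (simp_all add: algebra_simps)
    then show "W = 1 - a * p ^ (3 * (n + Suc m))" "W = 1 - a * p ^ (3 * (Suc n + m))" by (simp_all add: W_def mult.assoc)
  qed
  have F1: "qF p b e a n (Suc m) = h * k / e * W * (1 - e * y^2)"
    unfolding qF_def hr Weq(1)[symmetric] by simp
  have F2: "qF p b e a (Suc n) m = - (h * k * W * M * y^2 / (D2 * D3))"
    unfolding qF_def hl Weq(2)[symmetric] M_def by simp
  have G1: "qG p b e a n (Suc m) = - (h * k / e * (1 - e * y^2) * Q / (D2 * D3))"
  proof -
    have "p ^ (n + Suc m) = p * z" "p ^ (n + Suc m + 1) = p^2 * z" "p ^ (3 * n + Suc m + 1) = p^2 * x^3 * y"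
        "p ^ (3 * n + Suc m + 2) = p^3 * x^3 * y"
      unfolding z_def x_def y_def by (simp_all add: power_add power2_eq_square power3_eq_cube power_mult mult.commute[of 3])
    then show ?thesis unfolding qG_def hr Q_def D2_def D3_def by (simp only: divide_inverse mult_ac)
  qed
  have G2: "qG p b e a n m = - (h * k / e * (A1 * A2 * A3) / D2)"
  proof -
    have "p ^ (n + m + 1) = p * z" using pw by simp
    then have "qG p b e a n m = - (h * ((1 - a * z) * (1 - b * z) * (1 - p * z / b)) * (a / e * (p * x^3 * y)) / (D1 * D2))"
      unfolding qG_def pw h_def[symmetric] D1_def D2_def by (simp only: mult.assoc)
    \<comment> \<open>The term at \<open>m\<close> is expressed through the step ratio
      \<open>k\<close> as well; this moves the denominators \<open>A1\<close>, \<open>A2\<close>,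
      \<open>A3\<close> of \<open>k\<close> into the numerator and cancels
      \<open>D1\<close>.\<close>
    also have "\<dots> = - (h * k / e * (A1 * A2 * A3) / D2)"
      unfolding k_def using nz by (simp add: field_simps)
    finally show ?thesis .
  qed
  have P: "W * ((1 - e * y^2) * D2 * D3 + e * M * y^2) = A1 * A2 * A3 * D3 - (1 - e * y^2) * Q"
    using wz_poly_acceleration[of a x y]
    unfolding W_def M_def Q_def A1_def A2_def A3_def D2_def D3_def z_def
    by (simp only: mult.assoc)
  have "qF p b e a n (Suc m) - qF p b e a (Suc n) m = h * k / (e * D2 * D3) * (W * ((1 - e * y^2) * D2 * D3 + e * M * y^2))"
    unfolding F1 F2 using nz by (simp add: field_simps)
  also have "\<dots> = qG p b e a n (Suc m) - qG p b e a n m"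
    unfolding P G1 G2 using nz by (simp add: field_simps)
  finally show ?thesis .
qed

lemma qsummand_Lim:
  assumes "0 < a" "a \<le> e"
  shows "qsummand p b e a n \<longlonglongrightarrow> 0"
proof -
  obtain K where K: "0 \<le> K"
    "\<forall>a n m. 0 < a \<longrightarrow> a \<le> e \<longrightarrow> \<bar>qsummand p b e a n m\<bar> \<le> K * (a / e) ^ m * p ^ (n + m)"
    using qsummand_bound by blast
  note B = parameter_bounds[OF assms]
  show ?thesis
  proof (rule Lim_null_comparison)
    show "(\<lambda>m. K * 1 * p ^ (m + n)) \<longlonglongrightarrow> 0"
      using p by (intro tendsto_mult_right_zero LIMSEQ_ignore_initial_segment LIMSEQ_power_zero) simp
    have "norm (qsummand p b e a n m) \<le> K * 1 * p ^ (m + n)" for m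
    proof -
      have "K * (a / e) ^ m * p ^ (n + m) \<le> K * 1 * p ^ (n + m)"
        using B(15,16) K(1) p by (intro mult_right_mono mult_left_mono power_le_one) simp_all
      with K(2)[rule_format, OF assms, of n m] show ?thesis by (simp add: add.commute)
    qed
    then show "\<forall>\<^sub>F m in sequentially. norm (qsummand p b e a n m) \<le> K * 1 * p ^ (m + n)" by simp
  qed
qed

lemma qG_Lim:
  assumes "0 < a" "a \<le> e"
  shows "qG p b e a n \<longlonglongrightarrow> 0"
proof -
  note B = parameter_bounds[OF assms]
  have bp: "b \<noteq> 0" "p / b < 1" "0 < p / b" using b_pos p b by simp_all
  have den: "(\<lambda>m. 1 - a / e * p ^ (3 * n + m + j)) \<longlonglongrightarrow> 1 - a / e * 0" for j
  proof -
    have "(\<lambda>m. p ^ m) \<longlonglongrightarrow> 0" using p by (intro LIMSEQ_power_zero) simp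
    from LIMSEQ_ignore_initial_segment[OF this, of "3 * n + j"]
    show ?thesis by (intro tendsto_intros) (simp add: ac_simps)
  qed
  have pw: "(\<lambda>m. p ^ (m + k)) \<longlonglongrightarrow> 0" for k
    using p by (intro LIMSEQ_ignore_initial_segment LIMSEQ_power_zero) simp
  have h: "qsummand p b e a n \<longlonglongrightarrow> 0" by (rule qsummand_Lim[OF assms])
  have "(\<lambda>m. - (qsummand p b e a n m * (1 - a * p ^ (m + n)) * (1 - b * p ^ (m + n)) * (1 - p ^ (m + (n + 1)) / b)
        * (a / e) * p ^ (m + (3 * n + 1))
        / ((1 - a / e * p ^ (3 * n + m + 1)) * (1 - a / e * p ^ (3 * n + m + 2)))))
      \<longlonglongrightarrow> - (0 * (1 - a * 0) * (1 - b * 0) * (1 - 0 / b) * (a / e) * 0 / ((1 - a / e * 0) * (1 - a / e * 0)))"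
    by (intro tendsto_intros h pw den bp(1)) simp
  then show ?thesis unfolding qG_def by (simp add: ac_simps)
qed

text \<open>Summing the pair over \<open>m\<close> gives R n - R (n + 1) as the boundary term at
  \<open>m = 0\<close>, since \<open>qG\<close> vanishes at infinity; R n is O(p^n) because its
  index starts at \<open>n\<close>.\<close>

lemma acceleration:
  assumes "0 < a" "a \<le> e"
  shows "(\<lambda>n. qF p b e a n 0 - qG p b e a n 0) sums (\<Sum>m. qF p b e a 0 m)"
proof -
  define R where "R n = (\<Sum>m. qF p b e a n m)" for n
  have sF: "qF p b e a n sums R n" for n
    unfolding R_def using qF_summable[OF assms] by (simp add: summable_sums)
  have step: "R n - R (Suc n) = qF p b e a n 0 - qG p b e a n 0" for n
  proof -
    have "(\<lambda>m. qF p b e a n (Suc m) - qF p b e a (Suc n) m) sums ((R n - qF p b e a n 0) - R (Suc n))"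
      by (intro sums_diff sF) (use sF[of n] in \<open>simp add: sums_Suc_iff\<close>)
    moreover have "(\<lambda>m. qG p b e a n (Suc m) - qG p b e a n m) sums (0 - qG p b e a n 0)"
      by (rule telescope_sums[OF qG_Lim[OF assms]])
    ultimately have "(R n - qF p b e a n 0) - R (Suc n) = 0 - qG p b e a n 0"
      unfolding qF_qG_pair[OF assms] by (rule sums_unique2)
    then show ?thesis by simp
  qed
  obtain K where K: "0 \<le> K"
    "\<forall>a n m. 0 < a \<longrightarrow> a \<le> e \<longrightarrow> \<bar>qsummand p b e a n m\<bar> \<le> K * (a / e) ^ m * p ^ (n + m)"
    using qsummand_bound by blast
  have "R \<longlonglongrightarrow> 0"
  proof (rule Lim_null_comparison)
    have le: "\<bar>qF p b e a n m\<bar> \<le> K * p ^ n * p ^ m" for n m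
    proof (rule qF_bound[OF assms order.trans[OF K(2)[rule_format, OF assms]]])
      have "K * p ^ (n + m) * (a / e) ^ m \<le> K * p ^ (n + m) * 1"
        using parameter_bounds(15,16)[OF assms] K(1) p by (intro mult_left_mono power_le_one) simp_all
      then show "K * (a / e) ^ m * p ^ (n + m) \<le> K * p ^ n * p ^ m"
        by (simp only: power_add mult_ac mult_1_left)
    qed
    have "norm (R n) \<le> K * p ^ n * (1 / (1 - p))" for n
    proof -
      have g: "(\<lambda>m. K * p ^ n * p ^ m) sums (K * p ^ n * (1 / (1 - p)))"
        using p by (intro sums_mult geometric_sums) simp
      have "norm (R n) \<le> (\<Sum>m. K * p ^ n * p ^ m)"
        unfolding R_def by (rule norm_suminf_le) (use le g in \<open>simp_all add: sums_iff\<close>)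
      with g show ?thesis by (simp add: sums_iff)
    qed
    then show "\<forall>\<^sub>F n in sequentially. norm (R n) \<le> K * p ^ n * (1 / (1 - p))" by simp
    have "(\<lambda>n. K * p ^ n * (1 / (1 - p))) \<longlonglongrightarrow> K * 0 * (1 / (1 - p))"
      using p by (intro tendsto_intros LIMSEQ_power_zero) simp
    then show "(\<lambda>n. K * p ^ n * (1 / (1 - p))) \<longlonglongrightarrow> 0" by simp
  qed
  from telescope_sums'[OF this] show ?thesis unfolding step by (simp add: R_def)
qed


section \<open>Recurrence in a and the closed form of the quadratic series\<close>

definition qV :: "real \<Rightarrow> nat \<Rightarrow> real" where
  "qV a k = - ((1 - p ^ (2 * k)) * (1 - a^2 * p ^ (2 * k + 1) / e) / (1 - a * p ^ (k + 1) / e)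
     * qsummand p b e a 0 k)"

text \<open>Quotient of the closed forms at \<open>a\<close> and \<open>a * p^2\<close>: the first
  factors of the eight infinite products in \<open>quadratic_sum\<close>.\<close>

definition qC :: "real \<Rightarrow> real" where
  "qC a = (1 - a) * (1 - a * p) * (1 - a * p^2 / (b * e)) * (1 - a * b * p / e)
     / ((1 - a * p / e) * (1 - a * p^2 / e) * (1 - a * p^2 / b) * (1 - a * b * p))"

lemma shift_parameter:
  assumes "0 < a" "a \<le> e"
  shows "0 < a * p^2" "a * p^2 \<le> e"
proof -
  have "p^2 \<le> 1" using p by (simp add: power_le_one)
  then have "a * p^2 \<le> a * 1" using assms by (intro mult_left_mono) simp_all
  also have "a * 1 \<le> e" using assms by simp
  finally show "a * p^2 \<le> e" .
qed (use assms p in simp)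

text \<open>When \<open>a\<close> becomes \<open>a * p^2\<close>, factorials to base
  \<open>p\<close> move two places and those to base \<open>p^2\<close> one place. The factors free
  of \<open>k\<close> that this leaves cancel against \<open>qC\<close>, of which two numerator
  factors survive.\<close>

lemma qsummand_shift:
  fixes k :: nat
  assumes a: "0 < a" "a \<le> e"
  defines "z \<equiv> p ^ k"
  shows "qC a * qsummand p b e (a * p^2) 0 k = qsummand p b e a 0 k *
     ((1 - a * z) * (1 - a * p * z) * (1 - a * p^2 / (b * e)) * (1 - a * b * p / e) * z^2
      / ((1 - a * p^2 / b * z^2) * (1 - a * b * p * z^2) * (1 - a * p * z / e) * (1 - a * p^2 * z / e)))"
proof -
  note B = parameter_bounds[OF a]
  have p2: "0 < p^2" "p^2 < 1" using p by (auto simp: power_less_one_iff)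
  have z2: "(p^2) ^ k = z^2" unfolding z_def by (simp flip: power_mult add: mult.commute)
  have sh: "qpoch (r * x) r k = qpoch x r k * (1 - r ^ k * x) / (1 - x)" if "x \<noteq> 1" for x r
    using qpoch_shift[of x r k] that by (simp add: field_simps)
  have ne: "a \<noteq> 1" "a * p \<noteq> 1" "a * p^2 / b \<noteq> 1" "a * b * p \<noteq> 1" "a * p / e \<noteq> 1" "a * p^2 / e \<noteq> 1"
  proof -
    have "a * p < 1 * 1" using B(13,14) p by (intro mult_strict_mono) simp_all
    then show "a \<noteq> 1" "a * p \<noteq> 1" using B(14) by simp_all
    show "a * p^2 / b \<noteq> 1" "a * b * p \<noteq> 1" "a * p / e \<noteq> 1" "a * p^2 / e \<noteq> 1"
      using B(2,4,6,8) p(2) by linarith+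
  qed
  have fne: "1 - p ^ j * x \<noteq> 0" "1 - (p^2) ^ j * x \<noteq> 0" "qpoch x p j \<noteq> 0" "qpoch x (p^2) j \<noteq> 0" if "0 < x" "x \<le> p" for x j
    using qpoch_factor_pos[of p x j] qpoch_factor_pos[of "p^2" x j] qpoch_pos[of p x j] qpoch_pos[of "p^2" x j] p p2 that by auto
  have zne: "1 - z * (a * p / e) \<noteq> 0" "1 - z * (a * p^2 / e) \<noteq> 0" "1 - z^2 * (a * p^2 / b) \<noteq> 0" "1 - z^2 * (a * b * p) \<noteq> 0"
    using fne(1)[of "a * p / e" k] fne(1)[of "a * p^2 / e" k] fne(2)[of "a * p^2 / b" k] fne(2)[of "a * b * p" k] B
    by (simp_all add: z2 z_def)
  define N where "N = qpoch b p k * qpoch (p / b) p k * qpoch e (p^2) k / qpoch (p^2) (p^2) k * p ^ (\<Sum>{..k})"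
  have h: "qsummand p b e a' 0 k = N * (qpoch a' p k / (qpoch (a' * p^2 / b) (p^2) k * qpoch (a' * b * p) (p^2) k
        * qpoch (a' * p / e) p k)) * (a' / e) ^ k" for a'
    unfolding qsummand_def N_def by (simp add: mult_ac)
  have num: "qpoch (a * p^2) p k = qpoch a p k * ((1 - a * z) * (1 - a * p * z)) / ((1 - a) * (1 - a * p))"
    using sh[of a p] sh[of "a * p" p] ne(1,2) by (simp add: z_def power2_eq_square mult_ac)
  have d1: "qpoch (a * p^2 * p^2 / b) (p^2) k = qpoch (a * p^2 / b) (p^2) k * (1 - a * p^2 / b * z^2) / (1 - a * p^2 / b)"
    using sh[of "a * p^2 / b" "p^2"] ne(3) by (simp add: z2 mult_ac)
  have d2: "qpoch (a * p^2 * b * p) (p^2) k = qpoch (a * b * p) (p^2) k * (1 - a * b * p * z^2) / (1 - a * b * p)"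
    using sh[of "a * b * p" "p^2"] ne(4) by (simp add: z2 mult_ac)
  have d3: "qpoch (a * p^2 * p / e) p k = qpoch (a * p / e) p k * ((1 - a * p * z / e) * (1 - a * p^2 * z / e))
      / ((1 - a * p / e) * (1 - a * p^2 / e))"
    using sh[of "a * p / e" p] sh[of "a * p^2 / e" p] ne(5,6) by (simp add: z_def power2_eq_square mult_ac)
  have pw: "(a * p^2 / e) ^ k = (a / e) ^ k * z^2"
    by (simp add: power_divide power_mult_distrib z2)
  define A A1 A2 A3 A4 where "A = (1 - a) * (1 - a * p)" and "A1 = 1 - a * p^2 / b" and "A2 = 1 - a * b * p"
    and "A3 = (1 - a * p / e) * (1 - a * p^2 / e)" and "A4 = (1 - a * p^2 / (b * e)) * (1 - a * b * p / e)"
  define Z Z1 Z2 Z3 where "Z = (1 - a * z) * (1 - a * p * z)" and "Z1 = 1 - a * p^2 / b * z^2" and "Z2 = 1 - a * b * p * z^2"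
    and "Z3 = (1 - a * p * z / e) * (1 - a * p^2 * z / e)"
  define Q Q1 Q2 Q3 where "Q = qpoch a p k" and "Q1 = qpoch (a * p^2 / b) (p^2) k" and "Q2 = qpoch (a * b * p) (p^2) k"
    and "Q3 = qpoch (a * p / e) p k"
  have nz: "A \<noteq> 0" "A1 \<noteq> 0" "A2 \<noteq> 0" "A3 \<noteq> 0" "Z1 \<noteq> 0" "Z2 \<noteq> 0" "Z3 \<noteq> 0" "Q1 \<noteq> 0" "Q2 \<noteq> 0" "Q3 \<noteq> 0"
    unfolding A_def A1_def A2_def A3_def Z1_def Z2_def Z3_def Q1_def Q2_def Q3_def
    using ne zne fne(3,4) B by (simp_all add: mult_ac)
  have e1: "qC a = A * A4 / (A3 * A1 * A2)" unfolding qC_def A_def A1_def A2_def A3_def A4_def by (simp only: mult.assoc)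
  have e2: "(1 - a * z) * (1 - a * p * z) * (1 - a * p^2 / (b * e)) * (1 - a * b * p / e) * z^2
      / ((1 - a * p^2 / b * z^2) * (1 - a * b * p * z^2) * (1 - a * p * z / e) * (1 - a * p^2 * z / e)) = Z * A4 * z^2 / (Z1 * Z2 * Z3)"
    unfolding Z_def Z1_def Z2_def Z3_def A4_def by (simp only: mult.assoc)
  have e3: "qsummand p b e (a * p^2) 0 k = N * (Q * Z / A / (Q1 * Z1 / A1 * (Q2 * Z2 / A2) * (Q3 * Z3 / A3))) * ((a / e) ^ k * z^2)"
    unfolding h num d1 d2 d3 pw A_def A1_def A2_def A3_def Z_def Z1_def Z2_def Z3_def Q_def Q1_def Q2_def Q3_def by (rule refl)
  have e4: "qsummand p b e a 0 k = N * (Q / (Q1 * Q2 * Q3)) * (a / e) ^ k"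
    unfolding h Q_def Q1_def Q2_def Q3_def by (rule refl)
  show ?thesis unfolding e1 e2 e3 e4 using nz by (simp add: field_simps)
qed


lemma qF_qV_pair:
  assumes a: "0 < a" "a \<le> e"
  shows "qF p b e a 0 k - qC a * qF p b e (a * p^2) 0 k = qV a (Suc k) - qV a k"
proof -
  note B = parameter_bounds[OF a]
  define z h where "z = p ^ k" and "h = qsummand p b e a 0 k"
  have p2: "0 < p^2" "p^2 < 1" using p by (auto simp: power_less_one_iff)
  have z2: "(p^2) ^ k = z^2" unfolding z_def by (simp flip: power_mult add: mult.commute)
  have fne: "1 - p ^ j * x \<noteq> 0" "1 - (p^2) ^ j * x \<noteq> 0" if "0 < x" "x \<le> p" for x j
    using qpoch_factor_pos[of p x j] qpoch_factor_pos[of "p^2" x j] p p2 that by auto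
  define X Z1 Z2 Y1 Y2 where "X = 1 - p^2 * z^2" and "Z1 = 1 - a * p^2 / b * z^2" and "Z2 = 1 - a * b * p * z^2"
    and "Y1 = 1 - a * p * z / e" and "Y2 = 1 - a * p^2 * z / e"
  have "X \<noteq> 0" using qpoch_factor_pos[of "p^2" "p^2" k] p2 by (simp add: X_def z2 mult_ac)
  with fne(1)[of "a * p / e" k] fne(1)[of "a * p^2 / e" k] fne(2)[of "a * p^2 / b" k] fne(2)[of "a * b * p" k] B
  have nz: "X \<noteq> 0" "Z1 \<noteq> 0" "Z2 \<noteq> 0" "Y1 \<noteq> 0" "Y2 \<noteq> 0" "e \<noteq> 0"
    using e by (simp_all add: z2 z_def[symmetric] Z1_def Z2_def Y1_def Y2_def mult_ac)
  define N M T where "N = (1 - a * z) * (1 - a * p * z) * (1 - a * p^2 / (b * e)) * (1 - a * b * p / e) * z^2"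
    and "M = (1 - a * z) * (1 - b * z) * (1 - p * z / b) * (1 - e * z^2)" and "T = a * p * z / e"
  define V1 V2 where "V1 = (1 - z^2) * (1 - a^2 * p * z^2 / e)" and "V2 = 1 - a^2 * p^3 * z^2 / e"
  have pw: "p ^ (3 * k) = z ^ 3" "p ^ (2 * k) = z ^ 2" "p ^ (2 * k + 1) = p * z^2" "p ^ (k + 1) = p * z"
    "p ^ (2 * Suc k) = p^2 * z^2" "p ^ (2 * Suc k + 1) = p^3 * z^2" "p ^ (Suc k + 1) = p^2 * z"
    by (simp_all add: z_def power_add power2_eq_square power3_eq_cube mult.commute[of _ k] power_mult)
  have F1: "qF p b e a 0 k = (1 - a * z^3) * h"
    unfolding qF_def h_def by (simp add: pw)
  have F2: "qC a * qF p b e (a * p^2) 0 k = (1 - a * p^2 * z^3) * (h * (N / (Z1 * Z2 * Y1 * Y2)))"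
  proof -
    have "qC a * qF p b e (a * p^2) 0 k = (1 - a * p^2 * z^3) * (qC a * qsummand p b e (a * p^2) 0 k)"
      unfolding qF_def by (simp add: pw)
    then show ?thesis unfolding qsummand_shift[OF a] N_def Z1_def Z2_def Y1_def Y2_def h_def z_def .
  qed
  have Vk: "qV a k = - (V1 / Y1 * h)"
    unfolding qV_def pw V1_def Y1_def h_def by (simp only: mult.assoc)
  have h': "qsummand p b e a 0 (Suc k) = h * (M * T / (X * Z1 * Z2 * Y1))"
    unfolding qsummand_Suc_right using nz
    by (simp add: h_def[symmetric] z_def[symmetric] pw M_def T_def X_def Z1_def Z2_def Y1_def mult_ac)
  have VS: "qV a (Suc k) = - (V2 / Y2 * h * (M * T / (Z1 * Z2 * Y1)))"
  proof -
    have "qV a (Suc k) = - (X * V2 / Y2 * (h * (M * T / (X * Z1 * Z2 * Y1))))"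
      unfolding qV_def pw h' V2_def Y2_def X_def by (simp only: mult.assoc)
    then show ?thesis using nz by simp
  qed
  have P: "(1 - a * z^3) * Z1 * Z2 * Y1 * Y2 - (1 - a * p^2 * z^3) * N = V1 * Z1 * Z2 * Y2 - V2 * M * T"
    using wz_poly_parameter[of a z] unfolding N_def M_def T_def V1_def V2_def Z1_def Z2_def Y1_def Y2_def
    by (simp only: mult.assoc)
  have "qF p b e a 0 k - qC a * qF p b e (a * p^2) 0 k
      = h / (Z1 * Z2 * Y1 * Y2) * ((1 - a * z^3) * Z1 * Z2 * Y1 * Y2 - (1 - a * p^2 * z^3) * N)"
    unfolding F1 F2 using nz by (simp add: field_simps)
  also have "\<dots> = qV a (Suc k) - qV a k"
    unfolding P Vk VS using nz by (simp add: field_simps)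
  finally show ?thesis .
qed

definition qS :: "real \<Rightarrow> real" where "qS a = (\<Sum>k. qF p b e a 0 k)"

lemma qS_step:
  assumes a: "0 < a" "a \<le> e"
  shows "qS a = qC a * qS (a * p^2)"
proof -
  have sF: "qF p b e a' 0 sums qS a'" if "0 < a'" "a' \<le> e" for a'
    unfolding qS_def using qF_summable[OF that] by (simp add: summable_sums)
  have "(\<lambda>k. qF p b e a 0 k - qC a * qF p b e (a * p^2) 0 k) sums (qS a - qC a * qS (a * p^2))"
    by (intro sums_diff sums_mult sF a shift_parameter)
  moreover have "qV a \<longlonglongrightarrow> 0"
  proof -
    have h: "qsummand p b e a 0 \<longlonglongrightarrow> 0"
      by (rule qsummand_Lim[OF a])
    have p2: "norm (p^2) < 1" using p by (simp add: power_less_one_iff)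
    have e0: "e \<noteq> 0" using e by simp
    have "(\<lambda>k. - ((1 - (p^2) ^ k) * (1 - a^2 * ((p^2) ^ k * p) / e) / (1 - a * (p ^ k * p) / e) * qsummand p b e a 0 k))
        \<longlonglongrightarrow> - ((1 - 0) * (1 - a^2 * (0 * p) / e) / (1 - a * (0 * p) / e) * 0)"
      by (intro tendsto_intros h LIMSEQ_power_zero p2 e0) (use p in simp_all)
    then show ?thesis unfolding qV_def by (simp add: power_add power_mult power_square mult_ac)
  qed
  then have "(\<lambda>k. qV a (Suc k) - qV a k) sums (0 - qV a 0)" by (rule telescope_sums)
  ultimately have "qS a - qC a * qS (a * p^2) = 0 - qV a 0"
    unfolding qF_qV_pair[OF a] by (rule sums_unique2)
  \<comment> \<open>The factor \<open>1 - p ^ (2 * k)\<close> vanishes at 0, so the telescoped sum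
    has no boundary term and the recurrence is homogeneous.\<close>
  moreover have "qV a 0 = 0" by (simp add: qV_def)
  ultimately show ?thesis by simp
qed

lemma qS_iterate:
  assumes a: "0 < a" "a \<le> e"
  shows "qS a = qpoch a (p^2) N * qpoch (a * p) (p^2) N * qpoch (a * p^2 / (b * e)) (p^2) N * qpoch (a * b * p / e) (p^2) N
     / (qpoch (a * p / e) (p^2) N * qpoch (a * p^2 / e) (p^2) N * qpoch (a * p^2 / b) (p^2) N * qpoch (a * b * p) (p^2) N)
     * qS (a * (p^2) ^ N)"
proof (induction N)
  case (Suc N)
  have le: "0 < a * (p^2) ^ N" "a * (p^2) ^ N \<le> e"
  proof -
    have "a * (p^2) ^ N \<le> a * 1" using a p by (intro mult_left_mono power_le_one) (simp_all add: power_le_one)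
    also have "a * 1 \<le> e" using a by simp
    finally show "a * (p^2) ^ N \<le> e" .
  qed (use a p in simp)
  show ?case
    unfolding Suc.IH qS_step[OF le] qC_def qpoch_Suc
    by (simp add: mult_ac)
qed simp

text \<open>The term of index 0 is 1 - a', and each later one carries at least one factor a'/e; with
  \<open>K\<close> independent of a' the tail is O(a').\<close>

lemma qS_near_0:
  "(\<lambda>N. qS (a * (p^2) ^ N)) \<longlonglongrightarrow> 1" if a: "0 < a" "a \<le> e"
proof -
  obtain K where K: "0 \<le> K"
    "\<forall>a n m. 0 < a \<longrightarrow> a \<le> e \<longrightarrow> \<bar>qsummand p b e a n m\<bar> \<le> K * (a / e) ^ m * p ^ (n + m)"
    using qsummand_bound by blast
  have le: "\<bar>qS a' - (1 - a')\<bar> \<le> a' * (K / e * (1 / (1 - p)))" if a': "0 < a'" "a' \<le> e" for a'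
  proof -
    note B = parameter_bounds[OF a']
    have t: "\<bar>qF p b e a' 0 (Suc k)\<bar> \<le> a' * (K / e) * p ^ k" for k
    proof (rule qF_bound[OF a' order.trans[OF K(2)[rule_format, OF a']]])
      have "K * (a' / e) ^ Suc k * p ^ (0 + Suc k) = (K * (a' / e) * p ^ k) * ((a' / e) ^ k * p)" by simp
      also have "\<dots> \<le> (K * (a' / e) * p ^ k) * (1 * 1)"
        using B(13,15,16) K(1) p e by (intro mult_left_mono mult_mono power_le_one) simp_all
      finally show "K * (a' / e) ^ Suc k * p ^ (0 + Suc k) \<le> a' * (K / e) * p ^ k" by (simp add: mult_ac)
    qed
    have g: "(\<lambda>k. a' * (K / e) * p ^ k) sums (a' * (K / e) * (1 / (1 - p)))"
      using p by (intro sums_mult geometric_sums) simp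
    have "qS a' = (\<Sum>k. qF p b e a' 0 (Suc k)) + qF p b e a' 0 0"
      unfolding qS_def using suminf_split_initial_segment[OF qF_summable[OF a'], of 0 1] by simp
    moreover have "qF p b e a' 0 0 = 1 - a'" by (simp add: qF_def qsummand_def)
    ultimately have "\<bar>qS a' - (1 - a')\<bar> = norm (\<Sum>k. qF p b e a' 0 (Suc k))" by simp
    also have "\<dots> \<le> (\<Sum>k. a' * (K / e) * p ^ k)"
      by (rule norm_suminf_le) (use t g in \<open>simp_all add: sums_iff\<close>)
    finally show ?thesis using g by (simp add: sums_iff)
  qed
  define A where "A N = a * (p^2) ^ N" for N
  have A: "A \<longlonglongrightarrow> 0"
    unfolding A_def using p by (intro tendsto_mult_right_zero LIMSEQ_power_zero) (simp add: power_less_one_iff)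
  have Ale: "0 < A N" "A N \<le> e" for N
  proof -
    have "a * (p^2) ^ N \<le> a * 1" using a p by (intro mult_left_mono power_le_one) (simp_all add: power_le_one)
    also have "a * 1 \<le> e" using a by simp
    finally show "A N \<le> e" unfolding A_def .
  qed (use a p in \<open>simp add: A_def\<close>)
  have "(\<lambda>N. qS (A N) - (1 - A N)) \<longlonglongrightarrow> 0"
  proof (rule Lim_null_comparison)
    show "\<forall>\<^sub>F N in sequentially. norm (qS (A N) - (1 - A N)) \<le> A N * (K / e * (1 / (1 - p)))"
      using le[OF Ale] by simp
    show "(\<lambda>N. A N * (K / e * (1 / (1 - p)))) \<longlonglongrightarrow> 0" by (rule tendsto_mult_left_zero[OF A])
  qed
  then have "(\<lambda>N. (qS (A N) - (1 - A N)) + (1 - A N)) \<longlonglongrightarrow> 0 + (1 - 0)"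
    by (intro tendsto_intros A)
  then show ?thesis by (simp add: A_def)
qed

theorem quadratic_sum:
  assumes a: "0 < a" "a \<le> e"
  shows "qS a = qpoch_inf a (p^2) * qpoch_inf (a * p) (p^2) * qpoch_inf (a * p^2 / (b * e)) (p^2) * qpoch_inf (a * b * p / e) (p^2)
     / (qpoch_inf (a * p / e) (p^2) * qpoch_inf (a * p^2 / e) (p^2) * qpoch_inf (a * p^2 / b) (p^2) * qpoch_inf (a * b * p) (p^2))"
proof -
  note B = parameter_bounds[OF a]
  have p2: "0 \<le> p^2" "p^2 < 1" using p by (auto simp: power_less_one_iff)
  have nz: "qpoch_inf x (p^2) \<noteq> 0" if "0 < x" "x \<le> p" for x
    using qpoch_inf_pos[of "p^2" x] p p2 that by simp
  let ?f = "\<lambda>N. qpoch a (p^2) N * qpoch (a * p) (p^2) N * qpoch (a * p^2 / (b * e)) (p^2) N * qpoch (a * b * p / e) (p^2) N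
     / (qpoch (a * p / e) (p^2) N * qpoch (a * p^2 / e) (p^2) N * qpoch (a * p^2 / b) (p^2) N * qpoch (a * b * p) (p^2) N)
     * qS (a * (p^2) ^ N)"
  have "?f \<longlonglongrightarrow> qpoch_inf a (p^2) * qpoch_inf (a * p) (p^2) * qpoch_inf (a * p^2 / (b * e)) (p^2) * qpoch_inf (a * b * p / e) (p^2)
     / (qpoch_inf (a * p / e) (p^2) * qpoch_inf (a * p^2 / e) (p^2) * qpoch_inf (a * p^2 / b) (p^2) * qpoch_inf (a * b * p) (p^2)) * 1"
    by (intro tendsto_intros qpoch_LIMSEQ p2 qS_near_0[OF a]) (use nz B in simp)
  moreover have "?f = (\<lambda>N. qS a)" using qS_iterate[OF a] by simp
  ultimately show ?thesis by (simp add: LIMSEQ_const_iff)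
qed

end

section \<open>The specialization in powers of the sixth root of \<open>q\<close>\<close>

text \<open>Here and below \<open>u\<close> stands for q^(1/6), which turns every exponent of (i)
  into a natural number except the -1 behind \<open>1 / u\<close>. This is the factor in
  braces.\<close>

definition bracket :: "real \<Rightarrow> nat \<Rightarrow> real" where
  "bracket u n = (1 + u ^ (3 * n + 1)) * (1 + u ^ (3 * n + 2)) * (1 + u ^ (3 * n + 3)) * (1 + u ^ (6 * n + 2))
     - u ^ (3 * n + 3) * (1 + u ^ (9 * n + 2))"

text \<open>The \<open>div\<close> is exact, since n and 9n + 11 have opposite parity. The constant
  \<open>1 + u^2\<close> is kept apart, to be grouped with \<open>bracket\<close>, whose quotient by
  it has a simple limit.\<close>

definition core :: "real \<Rightarrow> nat \<Rightarrow> real" where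
  "core u n = (-1) ^ n * ((qpoch (u^4) (u^3) n * qpoch (u^5) (u^3) n * qpoch (u^7) (u^3) n)
     * qpoch (1 / u) (u^6) n * qpoch (u^4) (u^6) n
     / (qpoch (u^6) (u^6) n * qpoch (u^12) (u^6) n * qpoch (u^9) (u^3) (3 * n)))
     * u ^ (n * (9 * n + 11) div 2)"

definition product_side :: "real \<Rightarrow> real" where
  "product_side u = (qpoch_inf (u^10) (u^6))^2 * (qpoch_inf (u^7) (u^6))^2
     / ((qpoch_inf (u^12) (u^6))^2 * qpoch_inf (u^9) (u^6) * qpoch_inf u (u^6))"

text \<open>For x = u^(3n) the left side is the joint numerator of \<open>qF\<close> and
  \<open>- qG\<close>. The three factors split off on the right are the denominators that appear
  when the factorials of the summand are shifted to those of \<open>core\<close>.\<close>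

lemma bracket_factorization:
  fixes u x :: real
  shows "(1 - u^7 * x^3) * (1 - u^3 * x^3) * (1 - u^6 * x^3) + (1 - u^7 * x) * (1 - u^2 * x) * (1 - u * x) * (u^3 * x^3)
    = ((1 + u * x) * (1 + u^2 * x) * (1 + u^3 * x) * (1 + u^2 * x^2) - u^3 * x * (1 + u^2 * x^3))
      * ((1 - u^2 * x) * (1 - u * x) * (1 - u^5 * x^2))"
  by algebra

lemma qparam_sixth_root:
  fixes u :: real
  assumes "0 < u" "u < 1"
  shows "qparam (u^3) (u^2) (u^7)"
proof
  show "u^3 < u^2" using assms by (intro power_strict_decreasing) auto
qed (use assms in \<open>simp_all add: power_less_one_iff\<close>)

text \<open>The summand has parameters u^2, u, u^5, u^3 where \<open>core\<close> has u^5, u^4, none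
  and u^9. \<open>qpoch_shift\<close> trades them for constants and rational factors in x, and the
  latter cancel through \<open>bracket_factorization\<close>.\<close>

lemma qF_minus_qG:
  fixes u :: real
  assumes u: "0 < u" "u < 1"
  shows "qF (u^3) (u^2) (u^7) (u^7) n 0 - qG (u^3) (u^2) (u^7) (u^7) n 0
    = (1 - u^4) * (1 - u^5) * (1 - u) / ((1 - u^3) * (1 - u^6)) * (core u n * bracket u n / (1 + u^2))"
proof -
  define x where "x = u ^ (3 * n)"
  have ux: "(u^3) ^ n = x" "(u^6) ^ n = x^2" "(u^3) ^ (3 * n) = x^3"
    unfolding x_def by (simp_all flip: power_mult add: mult.commute)
  have lt1: "u ^ k < 1" if "k > 0" for k using u that by (simp add: power_less_one_iff)
  have ne1: "1 - u ^ k \<noteq> 0" if "k > 0" for k using lt1[OF that] by simp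
  have x: "0 < x" "x \<le> 1" unfolding x_def using u by (simp_all add: power_le_one)
  have nz: "1 - u^k * x^j \<noteq> 0" if "k > 0" for k j
  proof -
    have "u^k * x^j \<le> u^k * 1" using u x by (intro mult_left_mono power_le_one) simp_all
    with lt1[OF that] show ?thesis by simp
  qed
  have Q: "qpoch (u^j) (u^k) i \<noteq> 0" if "j > 0" for i j k
    using qpoch_pos[of "u^k" "u^j" i] u lt1[OF that] by (simp add: power_le_one)
  define T where "T = qpoch (u^7) (u^3) n * qpoch (1 / u) (u^6) n * qpoch (u^4) (u^6) n * (-1) ^ n * u ^ (n * (9 * n + 11) div 2)
     / (qpoch (u^6) (u^6) n * qpoch (u^12) (u^6) n)"
  have core: "core u n = T * qpoch (u^4) (u^3) n * qpoch (u^5) (u^3) n / qpoch (u^9) (u^3) (3 * n)"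
    unfolding core_def T_def by (simp add: mult_ac)
  have expo: "(- (u^7)) ^ n * (u^3) ^ (n * (n - 1) + \<Sum>{..n}) = (-1) ^ n * u ^ (n * (9 * n + 11) div 2)"
  proof -
    have "2 * (7 * n + 3 * (n * (n - 1) + \<Sum>{..n})) = n * (9 * n + 11)"
    proof -
      have g: "2 * \<Sum>{..n} = n * (n + 1)" by (induction n) simp_all
      have "2 * (7 * n + 3 * (n * (n - 1) + \<Sum>{..n})) = 14 * n + 6 * (n * (n - 1)) + 3 * (2 * \<Sum>{..n})" by simp
      also have "\<dots> = n * (9 * n + 11)" unfolding g by (cases n) (simp_all add: algebra_simps)
      finally show ?thesis .
    qed
    then have "7 * n + 3 * (n * (n - 1) + \<Sum>{..n}) = n * (9 * n + 11) div 2"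
      by (metis nonzero_mult_div_cancel_left zero_neq_numeral)
    moreover have "(- (u^7)) ^ n = (-1) ^ n * u ^ (7 * n)" by (simp add: power_minus[of "u^7"] power_mult)
    moreover have "(u^3) ^ (n * (n - 1) + \<Sum>{..n}) = u ^ (3 * (n * (n - 1) + \<Sum>{..n}))" by (simp only: power_mult)
    ultimately show ?thesis by (simp only: mult.assoc power_add[symmetric])
  qed
  have args: "u^3 / u^2 = u" "u^7 * (u^3)^2 / (u^2 * u^7) = u^4" "u^7 * u^2 * u^3 / u^7 = u^5" "(u^3)^2 = u^6"
      "(u^3)^2 / u^7 = 1 / u" "u^7 * (u^3)^2 / u^2 = u^11" "u^7 * u^2 * u^3 = u^12" "u^7 * u^3 / u^7 = u^3" "u^7 / u^7 = 1"
    using u by (simp_all add: field_simps power_numeral_reduce)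
  have h: "qsummand (u^3) (u^2) (u^7) (u^7) n 0 = T * qpoch (u^2) (u^3) n * qpoch u (u^3) n * qpoch (u^5) (u^6) n
      / (qpoch (u^11) (u^6) n * qpoch (u^3) (u^3) (3 * n))"
    using expo unfolding qsummand_def args(1-3,5,6,8,9) unfolding args(4,7) T_def by (simp add: mult_ac)
  have s1: "qpoch (u^2) (u^3) n = (1 - u^2) * qpoch (u^5) (u^3) n / (1 - u^2 * x)"
    using qpoch_shift[of "u^2" "u^3" n] nz[of 2 1] by (simp add: ux field_simps flip: power_add)
  have s2: "qpoch u (u^3) n = (1 - u) * qpoch (u^4) (u^3) n / (1 - u * x)"
    using qpoch_shift[of "u" "u^3" n] nz[of 1 1] by (simp add: ux field_simps flip: power_Suc power_Suc2)
  have s3: "qpoch (u^5) (u^6) n = (1 - u^5) * qpoch (u^11) (u^6) n / (1 - u^5 * x^2)"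
    using qpoch_shift[of "u^5" "u^6" n] nz[of 5 2] by (simp add: ux field_simps flip: power_add)
  have s4: "qpoch (u^3) (u^3) (3 * n) = (1 - u^3) * (1 - u^6) * qpoch (u^9) (u^3) (3 * n) / ((1 - u^3 * x^3) * (1 - u^6 * x^3))"
  proof -
    define P3 P6 P9 where "P3 = qpoch (u^3) (u^3) (3 * n)" and "P6 = qpoch (u^6) (u^3) (3 * n)" and "P9 = qpoch (u^9) (u^3) (3 * n)"
    have e: "u^3 * u^3 = u^6" "u^3 * u^6 = u^9" by (simp_all flip: power_add)
    have "P3 * (1 - x^3 * u^3) = (1 - u^3) * P6" "P6 * (1 - x^3 * u^6) = (1 - u^6) * P9"
      using qpoch_shift[of "u^3" "u^3" "3 * n", unfolded ux e] qpoch_shift[of "u^6" "u^3" "3 * n", unfolded ux e]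
      by (simp_all only: P3_def P6_def P9_def)
    then have "P3 * ((1 - u^3 * x^3) * (1 - u^6 * x^3)) = (1 - u^3) * (1 - u^6) * P9"
      by algebra
    then show ?thesis unfolding P3_def[symmetric] P9_def[symmetric] using nz[of 3 3] nz[of 6 3]
      by (simp only: nonzero_eq_divide_eq mult_eq_0_iff simp_thms zero_less_numeral)
  qed
  define X1 X2 X3 Y1 Y2 where "X1 = 1 - u^2 * x" and "X2 = 1 - u * x" and "X3 = 1 - u^5 * x^2"
    and "Y1 = 1 - u^3 * x^3" and "Y2 = 1 - u^6 * x^3"
  have XY: "X1 \<noteq> 0" "X2 \<noteq> 0" "X3 \<noteq> 0" "Y1 \<noteq> 0" "Y2 \<noteq> 0" "1 - u^3 \<noteq> 0" "1 - u^6 \<noteq> 0"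
     "qpoch (u^11) (u^6) n \<noteq> 0" "qpoch (u^9) (u^3) (3 * n) \<noteq> 0" "1 + u^2 \<noteq> 0"
    using nz[of 2 1] nz[of 1 1] nz[of 5 2] nz[of 3 3] nz[of 6 3] ne1[of 3] ne1[of 6] Q[of 11 6 n] Q[of 9 3 "3*n"] 
      add_pos_pos[of 1 "u^2"] u
    unfolding X1_def X2_def X3_def Y1_def Y2_def by simp_all
  have h': "qsummand (u^3) (u^2) (u^7) (u^7) n 0 = core u n * ((1 - u^2) * (1 - u) * (1 - u^5) / ((1 - u^3) * (1 - u^6)))
      * (Y1 * Y2 / (X1 * X2 * X3))"
  proof -
    have "T * (w2 * Q5 / X1) * (w1 * Q4 / X2) * (w5 * Q11 / X3) / (Q11 * (w3 * w6 * Q9 / (Y1 * Y2)))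
      = T * Q4 * Q5 / Q9 * (w2 * w1 * w5 / (w3 * w6)) * (Y1 * Y2 / (X1 * X2 * X3))"
      if "w3 \<noteq> 0" "w6 \<noteq> 0" "Q11 \<noteq> 0" "Q9 \<noteq> 0" for w1 w2 w3 w5 w6 Q4 Q5 Q9 Q11 :: real
      using XY(1-5) that by (simp add: field_simps)
    from this[OF XY(6-9)] show ?thesis
      unfolding h core s1 s2 s3 s4 X1_def[symmetric] X2_def[symmetric] X3_def[symmetric] Y1_def[symmetric] Y2_def[symmetric] .
  qed
  have px: "u^7 * (u^3) ^ (3 * (n + 0)) = u^7 * x^3" "u^7 * (u^3) ^ (n + 0) = u^7 * x" "u^2 * (u^3) ^ (n + 0) = u^2 * x"
    "(u^3) ^ (n + 0 + 1) / u^2 = u * x" "(u^3) ^ (3 * n + 0 + 1) = u^3 * x^3" "(u^3) ^ (3 * n + 0 + 2) = u^6 * x^3"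
    unfolding add_0_right power_add ux power_one_right
    using u by (simp_all add: ac_simps power_numeral_reduce flip: power_mult)
  have br: "bracket u n = (1 + u * x) * (1 + u^2 * x) * (1 + u^3 * x) * (1 + u^2 * x^2) - u^3 * x * (1 + u^2 * x^3)"
  proof -
    have "u ^ (3 * n + 1) = u * x" "u ^ (3 * n + 2) = u^2 * x" "u ^ (3 * n + 3) = u^3 * x" "u ^ (6 * n + 2) = u^2 * x^2"
      "u ^ (9 * n + 2) = u^2 * x^3"
      unfolding x_def power_add by (simp_all add: mult.commute flip: power_mult)
    then show ?thesis unfolding bracket_def by (simp only:)
  qed
  have "qF (u^3) (u^2) (u^7) (u^7) n 0 - qG (u^3) (u^2) (u^7) (u^7) n 0
     = qsummand (u^3) (u^2) (u^7) (u^7) n 0 / (Y1 * Y2) * ((1 - u^7 * x^3) * Y1 * Y2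
         + (1 - u^7 * x) * (1 - u^2 * x) * (1 - u * x) * (u^3 * x^3))"
    unfolding qF_def qG_def px args mult_1_left Y1_def[symmetric] Y2_def[symmetric] using XY by (simp add: field_simps)
  also have "(1 - u^7 * x^3) * Y1 * Y2 + (1 - u^7 * x) * (1 - u^2 * x) * (1 - u * x) * (u^3 * x^3) = bracket u n * (X1 * X2 * X3)"
    unfolding br X1_def X2_def X3_def Y1_def Y2_def by (rule bracket_factorization)
  also have "qsummand (u^3) (u^2) (u^7) (u^7) n 0 / (Y1 * Y2) * (bracket u n * (X1 * X2 * X3))
     = core u n * bracket u n * ((1 - u^2) * (1 - u) * (1 - u^5) / ((1 - u^3) * (1 - u^6)))"
    unfolding h' using XY by simp
  \<comment> \<open>The source of the factor 1 + q^(1/3) in the denominator of (i).\<close>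
  also have "1 - u^2 = (1 - u^4) / (1 + u^2)"
    using XY by (simp add: field_simps flip: power_add)
  finally show ?thesis by (simp add: mult_ac)
qed

lemma sums_product_side:
  fixes u :: real
  assumes u: "0 < u" "u < 1"
  shows "(\<lambda>n. core u n * bracket u n / (1 + u^2)) sums product_side u"
proof -
  interpret qparam "u^3" "u^2" "u^7" by (rule qparam_sixth_root[OF u])
  have lt1: "u ^ k < 1" if "k > 0" for k using u that by (simp add: power_less_one_iff)
  have pos: "0 < qpoch_inf (u ^ k) (u^6)" if "k > 0" for k
    using u lt1 that by (intro qpoch_inf_pos) simp_all
  have shift: "qpoch_inf (u^k) (u^6) = (1 - u^k) * qpoch_inf (u^(k + 6)) (u^6)" for k
    using qpoch_inf_shift[of "u^6" "u^k"] lt1[of 6] u by (simp add: power_add mult.commute)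
  \<comment> \<open>The constant of \<open>qF_minus_qG\<close>. It also separates the quadratic sum
    from \<open>product_side\<close>, so it divides out in the end.\<close>
  define c where "c = (1 - u^4) * (1 - u^5) * (1 - u) / ((1 - u^3) * (1 - u^6))"
  have nz: "1 - u^k \<noteq> 0" if "k > 0" for k using lt1[OF that] by simp
  have c: "c \<noteq> 0" unfolding c_def using nz[of 4] nz[of 5] nz[of 1] nz[of 3] nz[of 6] by simp
  have args: "u^7 * (u^3)^2 / (u^2 * u^7) = u^4" "u^7 * u^2 * u^3 / u^7 = u^5" "(u^3)^2 = u^6"
      "u^7 * (u^3)^2 / u^7 = u^6" "u^7 * (u^3)^2 / u^2 = u^11" "u^7 * u^2 * u^3 = u^12" "u^7 * u^3 / u^7 = u^3" "u^7 * u^3 = u^10"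
    using u by (simp_all add: field_simps power_numeral_reduce)
  have "qS (u^7) = qpoch_inf (u^7) (u^6) * qpoch_inf (u^10) (u^6) * qpoch_inf (u^4) (u^6) * qpoch_inf (u^5) (u^6)
     / (qpoch_inf (u^3) (u^6) * qpoch_inf (u^6) (u^6) * qpoch_inf (u^11) (u^6) * qpoch_inf (u^12) (u^6))"
    \<comment> \<open>The order of unfolding matters: simplifying \<open>(u^3)^2\<close> or the bare
      products first would destroy the left sides of the quotient rules.\<close>
    by (rule quadratic_sum[of "u^7", unfolded args(1,2,4,5,7), unfolded args(3,6,8)]) (use u in simp_all)
  also have "\<dots> = c * product_side u"
  proof -
    define P7 P9 P10 P11 P12 where "P7 = qpoch_inf (u^7) (u^6)" and "P9 = qpoch_inf (u^9) (u^6)" and "P10 = qpoch_inf (u^10) (u^6)"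
      and "P11 = qpoch_inf (u^11) (u^6)" and "P12 = qpoch_inf (u^12) (u^6)"
    define w1 w3 w4 w5 w6 where "w1 = 1 - u" and "w3 = 1 - u^3" and "w4 = 1 - u^4" and "w5 = 1 - u^5" and "w6 = 1 - u^6"
    have "P7 \<noteq> 0" "P9 \<noteq> 0" "P10 \<noteq> 0" "P11 \<noteq> 0" "P12 \<noteq> 0" "w1 \<noteq> 0" "w3 \<noteq> 0" "w4 \<noteq> 0" "w5 \<noteq> 0" "w6 \<noteq> 0"
      using pos[of 7] pos[of 9] pos[of 10] pos[of 11] pos[of 12] nz[of 1] nz[of 3] nz[of 4] nz[of 5] nz[of 6]
      by (simp_all add: P7_def P9_def P10_def P11_def P12_def w1_def w3_def w4_def w5_def w6_def)
    then have eq: "P7 * P10 * (w4 * P10) * (w5 * P11) / (w3 * P9 * (w6 * P12) * P11 * P12)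
        = w4 * w5 * w1 / (w3 * w6) * (P10^2 * P7^2 / (P12^2 * P9 * (w1 * P7)))"
      by (simp add: field_simps power2_eq_square)
    have sh: "qpoch_inf (u^4) (u^6) = w4 * P10" "qpoch_inf (u^5) (u^6) = w5 * P11" "qpoch_inf (u^3) (u^6) = w3 * P9"
      "qpoch_inf (u^6) (u^6) = w6 * P12" "qpoch_inf u (u^6) = w1 * P7"
      using shift[of 4] shift[of 5] shift[of 3] shift[of 6] shift[of 1]
      by (simp_all add: P7_def P9_def P10_def P11_def P12_def w1_def w3_def w4_def w5_def w6_def)
    show ?thesis
      unfolding product_side_def c_def sh P7_def[symmetric] P9_def[symmetric] P10_def[symmetric] P11_def[symmetric] P12_def[symmetric]
        w1_def[symmetric] w3_def[symmetric] w4_def[symmetric] w5_def[symmetric] w6_def[symmetric]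
      by (rule eq)
  qed
  finally have S: "qS (u^7) = c * product_side u" .
  have "(\<lambda>n. c * (core u n * bracket u n / (1 + u^2))) sums (c * product_side u)"
    using acceleration[of "u^7"] u unfolding qF_minus_qG[OF u] c_def[symmetric] qS_def[symmetric] S by simp
  from sums_mult[OF this, of "1 / c"] c show ?thesis by simp
qed

section \<open>The limit \<open>q \<rightarrow> 1\<close>\<close>

abbreviation "to1 \<equiv> at_left (1::real)"

text \<open>The cut at 1/2 serves \<open>core_bound\<close>, where \<open>1 / u\<close> has to stay
  below 2.\<close>

lemma eventually_to1:
  assumes "\<And>u::real. 1/2 < u \<Longrightarrow> u < 1 \<Longrightarrow> P u"
  shows "eventually P to1"
  by (rule eventually_mono[OF eventually_at_left_real[of "1/2" 1]]) (use assms in auto)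

lemma qnumber_limit: "((\<lambda>u::real. (1 - u ^ k) / (1 - u)) \<longlongrightarrow> real k) to1"
proof (rule Lim_transform_eventually)
  have "((\<lambda>u::real. \<Sum>i<k. u ^ i) \<longlongrightarrow> (\<Sum>i<k. 1 ^ i)) to1"
    by (intro tendsto_intros)
  then show "((\<lambda>u::real. \<Sum>i<k. u ^ i) \<longlongrightarrow> real k) to1" by simp
  show "\<forall>\<^sub>F u in to1. (\<Sum>i<k. u ^ i) = (1 - u ^ k) / (1 - u)"
    by (rule eventually_to1) (simp add: one_diff_power_eq)
qed

lemma qpoch_limit:
  "((\<lambda>u::real. qpoch (u ^ c) (u ^ d) n / (1 - u) ^ n) \<longlongrightarrow> (\<Prod>j<n. real (d * j + c))) to1"
proof -
  have "((\<lambda>u::real. \<Prod>j<n. (1 - u ^ (d * j + c)) / (1 - u)) \<longlongrightarrow> (\<Prod>j<n. real (d * j + c))) to1"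
    by (intro tendsto_prod qnumber_limit)
  moreover have "(\<Prod>j<n. (1 - u ^ (d * j + c)) / (1 - u)) = qpoch (u ^ c) (u ^ d) n / (1 - u) ^ n" for u :: real
    by (simp add: qpoch_def prod_dividef power_add power_mult)
  ultimately show ?thesis by simp
qed

text \<open>At j = 0 the exponent d j - 1 is negative, so each factor is rewritten through the
  quotient for d j, whose limit is known.\<close>

lemma qpoch_inverse_limit:
  "((\<lambda>u::real. qpoch (1 / u) (u ^ d) n / (1 - u) ^ n) \<longlongrightarrow> (\<Prod>j<n. real (d * j) - 1)) to1"
proof (rule Lim_transform_eventually)
  have "((\<lambda>u::real. \<Prod>j<n. ((1 - u ^ (d * j)) / (1 - u) - 1) / u) \<longlongrightarrow> (\<Prod>j<n. (real (d * j) - 1) / 1)) to1"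
    by (intro tendsto_intros qnumber_limit) simp
  then show "((\<lambda>u::real. \<Prod>j<n. ((1 - u ^ (d * j)) / (1 - u) - 1) / u) \<longlongrightarrow> (\<Prod>j<n. real (d * j) - 1)) to1"
    by simp
  show "\<forall>\<^sub>F u in to1. (\<Prod>j<n. ((1 - u ^ (d * j)) / (1 - u) - 1) / u) = qpoch (1 / u) (u ^ d) n / (1 - u) ^ n"
  proof (rule eventually_to1)
    fix u :: real assume u: "1/2 < u" "u < 1"
    have "((1 - u ^ (d * j)) / (1 - u) - 1) / u = (1 - (u ^ d) ^ j * (1 / u)) / (1 - u)" for j
      using u by (simp add: field_simps power_mult)
    then show "(\<Prod>j<n. ((1 - u ^ (d * j)) / (1 - u) - 1) / u) = qpoch (1 / u) (u ^ d) n / (1 - u) ^ n"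
      by (simp add: qpoch_def prod_dividef)
  qed
qed

lemma prod_arith_pochhammer:
  "d \<noteq> 0 \<Longrightarrow> (\<Prod>j<n. d * real j + c) = d ^ n * pochhammer (c / d) n"
  by (induction n) (simp_all add: pochhammer_Suc field_simps)

text \<open>The factors are grouped by residue modulo 3. In the limit term this cancels (4/3)_n
  (5/3)_n and supplies the second (1)_n and the base 27.\<close>

lemma pochhammer_3_triple:
  "pochhammer (3::real) (3 * n) = 27 ^ n * pochhammer 1 n * pochhammer (4/3) n * pochhammer (5/3) n"
proof (induction n)
  case (Suc n)
  have "3 * Suc n = Suc (Suc (Suc (3 * n)))" by simp
  then have "pochhammer (3::real) (3 * Suc n) = pochhammer 3 (3 * n) * ((3 + 3 * real n) * (4 + 3 * real n) * (5 + 3 * real n))"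
    by (simp only: pochhammer_Suc) (simp add: algebra_simps)
  with Suc show ?case by (simp add: pochhammer_Suc field_simps)
qed simp

definition limit_term :: "nat \<Rightarrow> real" where
  "limit_term n = (-1 / 27) ^ n * (pochhammer (2/3) n * pochhammer (7/3) n * pochhammer (-1/6) n
           / (pochhammer 1 n * pochhammer 1 n * pochhammer 2 n))"

text \<open>Numerator and denominator both have 5n factors of first order in 1 - u, the factorial of
  length 3n counting three times, so the normalizing powers cancel.\<close>

lemma core_limit: "((\<lambda>u. core u n) \<longlongrightarrow> limit_term n) to1"
proof (rule Lim_transform_eventually)
  let ?q = "\<lambda>c d k (u::real). qpoch (u ^ c) (u ^ d) k / (1 - u) ^ k"
  let ?r = "\<lambda>(u::real). qpoch (1 / u) (u ^ 6) n / (1 - u) ^ n"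
  let ?l = "\<lambda>d c n. \<Prod>j<n. real (d * j + c)"
  let ?f = "\<lambda>u. (-1) ^ n * ((?q 4 3 n u * ?q 5 3 n u * ?q 7 3 n u) * ?r u * ?q 4 6 n u / (?q 6 6 n u * ?q 12 6 n u * ?q 9 3 (3 * n) u))
       * u ^ (n * (9 * n + 11) div 2)"
  have nz: "?l d c k \<noteq> 0" if "c > 0" for d c k
  proof -
    have "0 < ?l d c k" by (rule prod_pos) (simp only: of_nat_0_less_iff add_gr_0 that simp_thms)
    then show ?thesis by (metis less_irrefl)
  qed
  have "(?f \<longlongrightarrow> (-1) ^ n * ((?l 3 4 n * ?l 3 5 n * ?l 3 7 n) * (\<Prod>j<n. real (6 * j) - 1) * ?l 6 4 n / (?l 6 6 n * ?l 6 12 n * ?l 3 9 (3 * n)))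
       * 1 ^ (n * (9 * n + 11) div 2)) to1"
    by (intro tendsto_intros qpoch_limit qpoch_inverse_limit) (use nz in simp)
  also have "(-1) ^ n * ((?l 3 4 n * ?l 3 5 n * ?l 3 7 n) * (\<Prod>j<n. real (6 * j) - 1) * ?l 6 4 n / (?l 6 6 n * ?l 6 12 n * ?l 3 9 (3 * n)))
       * 1 ^ (n * (9 * n + 11) div 2) = limit_term n"
  proof -
    have l: "?l d c k = real d ^ k * pochhammer (real c / real d) k" if "d > 0" for d c k
      using prod_arith_pochhammer[of "real d" "real c" k] that by simp
    have ls: "?l 3 4 n = 3 ^ n * pochhammer (4/3) n" "?l 3 5 n = 3 ^ n * pochhammer (5/3) n"
      "?l 3 7 n = 3 ^ n * pochhammer (7/3) n" "?l 6 4 n = 6 ^ n * pochhammer (2/3) n"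
      "?l 6 6 n = 6 ^ n * pochhammer 1 n" "?l 6 12 n = 6 ^ n * pochhammer 2 n"
      "?l 3 9 (3 * n) = 27 ^ n * pochhammer 3 (3 * n)"
      using l[of 3 4 n] l[of 3 5 n] l[of 3 7 n] l[of 6 4 n] l[of 6 6 n] l[of 6 12 n] l[of 3 9 "3 * n"]
      by (simp_all add: power_mult)
    have l': "(\<Prod>j<n. real (6 * j) - 1) = 6 ^ n * pochhammer (-1/6) n"
      using prod_arith_pochhammer[of 6 "-1" n] by simp
    have pos: "pochhammer (1::real) n \<noteq> 0" "pochhammer (2::real) n \<noteq> 0" "pochhammer (4/3::real) n \<noteq> 0" "pochhammer (5/3::real) n \<noteq> 0"
      using pochhammer_pos[of "1::real" n] pochhammer_pos[of "2::real" n] pochhammer_pos[of "4/3::real" n] pochhammer_pos[of "5/3::real" n]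
      by simp_all
    have "(27::real) ^ n = 3 ^ n * 3 ^ n * 3 ^ n" by (simp flip: power_mult_distrib)
    moreover have "(-1/27::real) ^ n = (-1) ^ n / 27 ^ n" by (rule power_divide)
    ultimately show ?thesis
      unfolding limit_term_def ls l' pochhammer_3_triple using pos by (simp add: mult_ac)
  qed
  finally show "(?f \<longlongrightarrow> limit_term n) to1" .
  show "\<forall>\<^sub>F u in to1. ?f u = core u n"
  proof (rule eventually_to1)
    fix u :: real assume u: "1/2 < u" "u < 1"
    define w where "w = (1 - u) ^ n"
    have "3 * n = n + n + n" by simp
    then have w: "w \<noteq> 0" "(1 - u) ^ (3 * n) = w * w * w"
      using u by (simp_all only: w_def power_add) simp
    show "?f u = core u n" unfolding core_def w(2) w_def[symmetric] using w(1) by (simp add: field_simps)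
  qed
qed

text \<open>At u = 1 the quotient is (16 - 2) / 2 for every \<open>n\<close>; this 7 reappears in
  \<open>Gamma_value\<close> and divides out at the end.\<close>

lemma bracket_limit: "((\<lambda>u. bracket u n / (1 + u^2)) \<longlongrightarrow> 7) to1"
proof -
  have "((\<lambda>u. bracket u n / (1 + u^2)) \<longlongrightarrow> ((1 + 1 ^ (3 * n + 1)) * (1 + 1 ^ (3 * n + 2)) * (1 + 1 ^ (3 * n + 3)) * (1 + 1 ^ (6 * n + 2))
     - 1 ^ (3 * n + 3) * (1 + 1 ^ (9 * n + 2))) / (1 + 1^2)) to1"
    unfolding bracket_def by (intro tendsto_intros) simp
  then show ?thesis by simp
qed

lemma core_Suc:
  fixes u :: real
  assumes u: "0 < u" "u < 1"
  shows "core u (Suc n) = core u n * - ((1 - u ^ (3 * n + 4)) / (1 - u ^ (9 * n + 9)) * ((1 - u ^ (3 * n + 5)) / (1 - u ^ (9 * n + 12)))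
     * ((1 - u ^ (3 * n + 7)) / (1 - u ^ (9 * n + 15))) * ((1 - u ^ (6 * n) / u) / (1 - u ^ (6 * n + 6)))
     * ((1 - u ^ (6 * n + 4)) / (1 - u ^ (6 * n + 12))) * u ^ (9 * n + 10))"
proof -
  have e: "Suc n * (9 * Suc n + 11) div 2 = n * (9 * n + 11) div 2 + (9 * n + 10)"
  proof -
    have "Suc n * (9 * Suc n + 11) = n * (9 * n + 11) + (9 * n + 10) * 2" by (simp add: algebra_simps)
    then show ?thesis by simp
  qed
  have t: "3 * Suc n = Suc (Suc (Suc (3 * n)))" by simp
  have f: "(u ^ d) ^ j * u ^ c = u ^ (d * j + c)" for c d j by (simp add: power_add power_mult)
  have f': "(u ^ 6) ^ n * (1 / u) = u ^ (6 * n) / u" by (simp add: power_mult)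
  have f9: "3 * (3 * n) + 9 = 9 * n + 9" "3 * Suc (3 * n) + 9 = 9 * n + 12" "3 * Suc (Suc (3 * n)) + 9 = 9 * n + 15" by simp_all
  define A1 A2 A3 A4 A5 B1 B2 B3 B4 B5 where "A1 = 1 - u ^ (3 * n + 4)" and "A2 = 1 - u ^ (3 * n + 5)"
    and "A3 = 1 - u ^ (3 * n + 7)" and "A4 = 1 - u ^ (6 * n) / u" and "A5 = 1 - u ^ (6 * n + 4)"
    and "B1 = 1 - u ^ (9 * n + 9)" and "B2 = 1 - u ^ (9 * n + 12)" and "B3 = 1 - u ^ (9 * n + 15)"
    and "B4 = 1 - u ^ (6 * n + 6)" and "B5 = 1 - u ^ (6 * n + 12)"
  show ?thesis
    unfolding core_def qpoch_Suc t e f f' f9 A1_def[symmetric] A2_def[symmetric] A3_def[symmetric] A4_def[symmetric] A5_def[symmetric]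
      B1_def[symmetric] B2_def[symmetric] B3_def[symmetric] B4_def[symmetric] B5_def[symmetric] power_add[of u _ "9 * n + 10"]
    by (simp add: mult_ac)
qed

text \<open>The step from 0 to 1 is exceptional: the quotient containing 1 - 1/u is only bounded by
  2. Starting the halving from there gives the constant 4.\<close>

lemma core_bound:
  fixes u :: real
  assumes u: "1/2 < u" "u < 1"
  shows "\<bar>core u n\<bar> \<le> 4 * (1/2) ^ n"
proof -
  have u0: "0 < u" using u by simp
  have lt1: "u ^ k < 1" if "k > 0" for k using u that by (simp add: power_less_one_iff)
  have q: "0 \<le> (1 - u ^ k) / (1 - u ^ l)" "(1 - u ^ k) / (1 - u ^ l) \<le> 1" if "k \<le> l" "0 < l" for k l
    using power_decreasing[of k l u] lt1[of l] u that by (simp_all add: power_le_one)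
  have step1: "\<bar>core u 1\<bar> \<le> 2"
  proof -
    have c: "core u (Suc 0) = - ((1 - u ^ 4) / (1 - u ^ 9) * ((1 - u ^ 5) / (1 - u ^ 12))
       * ((1 - u ^ 7) / (1 - u ^ 15)) * ((1 - 1 / u) / (1 - u ^ 6)) * ((1 - u ^ 4) / (1 - u ^ 12)) * u ^ 10)"
      using core_Suc[OF u0 u(2), of 0] by (simp add: core_def)
    have "\<bar>(1 - 1 / u) / (1 - u ^ 6)\<bar> = 1 / u * ((1 - u ^ 1) / (1 - u ^ 6))"
      using u lt1[of 6] by (simp add: field_simps abs_if)
    also have "\<dots> \<le> 2 * 1" using u q[of 1 6] by (intro mult_mono) (simp_all add: field_simps)
    finally have r: "\<bar>(1 - 1 / u) / (1 - u ^ 6)\<bar> \<le> 2" by simp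
    have a: "\<bar>(1 - u ^ k) / (1 - u ^ l)\<bar> \<le> 1" if "k \<le> l" "0 < l" for k l using q[OF that] by (simp only: abs_of_nonneg)
    have "\<bar>core u (Suc 0)\<bar> \<le> 1 * 1 * 1 * 2 * 1 * 1"
      unfolding c abs_minus_cancel abs_mult[of _ "(1 - u ^ k) / (1 - u ^ l)" for k l] abs_mult[of _ "(1 - 1 / u) / (1 - u ^ 6)"] abs_mult[of _ "u ^ 10"]
      by (intro mult_mono a r mult_nonneg_nonneg) (use u in \<open>simp_all add: power_le_one\<close>)
    then show ?thesis by simp
  qed
  have step: "\<bar>core u (Suc n)\<bar> \<le> \<bar>core u n\<bar> * (1/2)" if n: "n \<ge> 1" for n
  proof -
    \<comment> \<open>One quotient is at most 1/(1 + y) and the power of \<open>u\<close> at most y.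
      Since y/(1 + y) is at most 1/2 on the unit interval, this pair alone gives the halving,
      uniformly in \<open>u\<close>; the other quotients are at most 1.\<close>
    define y where "y = u ^ (3 * n + 4)"
    have y: "0 < y" "y < 1" unfolding y_def using u lt1 by simp_all
    have "u ^ (9 * n + 9) \<le> y ^ 2" unfolding y_def power_mult[symmetric] using u n by (intro power_decreasing) auto
    then have "(1 - y) / (1 - u ^ (9 * n + 9)) \<le> (1 - y) / (1 - y ^ 2)"
      using y by (intro divide_left_mono mult_pos_pos) (simp_all add: power_less_one_iff lt1)
    also have "1 - y ^ 2 = (1 - y) * (1 + y)" by algebra
    also have "(1 - y) / ((1 - y) * (1 + y)) = 1 / (1 + y)" using y by simp
    finally have 1: "(1 - y) / (1 - u ^ (9 * n + 9)) \<le> 1 / (1 + y)" .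
    have 2: "u ^ (9 * n + 10) \<le> y" unfolding y_def using u n by (intro power_decreasing) auto
    have 3: "(1 - u ^ (6 * n) / u) / (1 - u ^ (6 * n + 6)) = (1 - u ^ (6 * n - 1)) / (1 - u ^ (6 * n + 6))"
      using u n by (simp add: power_diff)
    define P where "P = (1 - y) / (1 - u ^ (9 * n + 9)) * u ^ (9 * n + 10)"
    have "P \<le> 1 / (1 + y) * y"
      unfolding P_def using 1 2 y u by (intro mult_mono) simp_all
    also have "\<dots> \<le> 1/2" using y by (simp add: field_simps)
    finally have P: "P \<le> 1/2" .
    have P0: "0 \<le> P" unfolding P_def y_def using u by (intro mult_nonneg_nonneg q) simp_all
    define R where "R = ((1 - u ^ (3 * n + 5)) / (1 - u ^ (9 * n + 12)))
     * ((1 - u ^ (3 * n + 7)) / (1 - u ^ (9 * n + 15))) * ((1 - u ^ (6 * n - 1)) / (1 - u ^ (6 * n + 6)))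
     * ((1 - u ^ (6 * n + 4)) / (1 - u ^ (6 * n + 12)))"
    have "R \<le> 1 * 1 * 1 * 1" unfolding R_def by (intro mult_mono q mult_nonneg_nonneg) simp_all
    moreover have R0: "0 \<le> R" unfolding R_def by (intro q mult_nonneg_nonneg) simp_all
    ultimately have "P * R \<le> 1/2 * 1" using P P0 by (intro mult_mono) simp_all
    then have le: "\<bar>P * R\<bar> \<le> 1/2 * 1" using P0 R0 by simp
    have "core u (Suc n) = core u n * - (P * R)"
      unfolding core_Suc[OF u0 u(2)] R_def 3 y_def P_def by (simp only: mult_ac)
    then have "\<bar>core u (Suc n)\<bar> = \<bar>core u n\<bar> * \<bar>P * R\<bar>"
      by (simp only: abs_mult abs_minus_cancel)
    also have "\<dots> \<le> \<bar>core u n\<bar> * (1/2 * 1)" by (intro mult_left_mono le) simp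
    finally show ?thesis by simp
  qed
  show ?thesis
  proof (cases n)
    case 0
    then show ?thesis by (simp add: core_def)
  next
    case (Suc m)
    have "\<bar>core u (Suc m)\<bar> \<le> 4 * (1/2) ^ Suc m"
    proof (induction m)
      case 0
      then show ?case using step1 by simp
    next
      case (Suc m)
      then show ?case using step[of "Suc m"] by simp
    qed
    with Suc show ?thesis by simp
  qed
qed

lemma bracket_bound:
  fixes u :: real
  assumes "0 < u" "u < 1"
  shows "\<bar>bracket u n / (1 + u^2)\<bar> \<le> 18"
proof -
  have p: "0 \<le> u ^ k" "u ^ k \<le> 1" for k using assms by (simp_all add: power_le_one)
  have 1: "(1 + u ^ (3 * n + 1)) * (1 + u ^ (3 * n + 2)) * (1 + u ^ (3 * n + 3)) * (1 + u ^ (6 * n + 2)) \<le> 2 * 2 * 2 * 2"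
    by (intro mult_mono mult_nonneg_nonneg add_nonneg_nonneg p) (simp_all only: one_add_one[symmetric] add_left_mono p zero_le_one add_nonneg_nonneg)
  have 2: "u ^ (3 * n + 3) * (1 + u ^ (9 * n + 2)) \<le> 1 * 2"
    by (intro mult_mono p) (simp_all only: one_add_one[symmetric] add_left_mono p zero_le_one add_nonneg_nonneg)
  have 3: "0 \<le> (1 + u ^ (3 * n + 1)) * (1 + u ^ (3 * n + 2)) * (1 + u ^ (3 * n + 3)) * (1 + u ^ (6 * n + 2))"
     "0 \<le> u ^ (3 * n + 3) * (1 + u ^ (9 * n + 2))"
    by (intro mult_nonneg_nonneg add_nonneg_nonneg p zero_le_one)+
  have "\<bar>bracket u n\<bar> \<le> 18" unfolding bracket_def using 1 2 3 by linarith
  moreover have "\<bar>bracket u n / (1 + u^2)\<bar> \<le> \<bar>bracket u n\<bar> / 1"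
    unfolding abs_divide by (intro divide_left_mono) (simp_all add: add_pos_nonneg)
  ultimately show ?thesis by simp
qed

lemma series_limit:
  "summable (\<lambda>n. norm (7 * limit_term n)) \<and> (product_side \<longlongrightarrow> (\<Sum>n. 7 * limit_term n)) to1"
proof -
  let ?a = "\<lambda>n u. core u n * (bracket u n / (1 + u^2))"
  have "((\<lambda>u. ?a n u) \<longlongrightarrow> 7 * limit_term n) to1" for n
    using tendsto_mult[OF core_limit bracket_limit] by (simp add: mult.commute)
  moreover have "\<forall>\<^sub>F (n, u) in at_top \<times>\<^sub>F to1. norm (?a n u) \<le> 72 * (1/2) ^ n"
  proof -
    have "\<forall>\<^sub>F nu in at_top \<times>\<^sub>F to1. True \<and> (1/2 < snd nu \<and> snd nu < 1)"
      using eventually_prodI[of "\<lambda>_. True" at_top "\<lambda>u. 1/2 < u \<and> u < 1" to1] eventually_to1[of "\<lambda>u. 1/2 < u \<and> u < 1"] by simp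
    then show ?thesis
    proof (rule eventually_mono)
      fix nu :: "nat \<times> real" assume nu: "True \<and> 1/2 < snd nu \<and> snd nu < 1"
      obtain n u where [simp]: "nu = (n, u)" by fastforce
      have "\<bar>core u n\<bar> * \<bar>bracket u n / (1 + u^2)\<bar> \<le> (4 * (1/2) ^ n) * 18"
        using nu by (intro mult_mono core_bound bracket_bound) simp_all
      then show "case nu of (n, u) \<Rightarrow> norm (core u n * (bracket u n / (1 + u^2))) \<le> 72 * (1/2) ^ n"
        by (simp add: abs_mult)
    qed
  qed
  moreover have "summable (\<lambda>n. 72 * (1/2::real) ^ n)" by (intro summable_mult summable_geometric) simp
  ultimately have T: "summable (\<lambda>n. norm (7 * limit_term n)) \<and> ((\<lambda>u. suminf (\<lambda>n. ?a n u)) \<longlongrightarrow> (\<Sum>n. 7 * limit_term n)) to1"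
    using tannerys_theorem[of ?a "\<lambda>n. 7 * limit_term n" to1 "\<lambda>n. 72 * (1/2) ^ n"] by simp
  have "\<forall>\<^sub>F u in to1. suminf (\<lambda>n. ?a n u) = product_side u"
    by (rule eventually_to1) (use sums_product_side in \<open>simp add: sums_iff\<close>)
  with T show ?thesis by (blast intro: Lim_transform_eventually)
qed


section \<open>The infinite product as u tends to 1\<close>

definition factor :: "nat \<Rightarrow> real \<Rightarrow> real" where
  "factor j u = (1 - u ^ (6 * j + 10))^2 * (1 - u ^ (6 * j + 7))^2
     / ((1 - u ^ (6 * j + 12))^2 * (1 - u ^ (6 * j + 9)) * (1 - u ^ (6 * j + 1)))"

definition limit_factor :: "nat \<Rightarrow> real" where
  "limit_factor j = (6 * real j + 10)^2 * (6 * real j + 7)^2 / ((6 * real j + 12)^2 * (6 * real j + 9) * (6 * real j + 1))"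

text \<open>Numerator minus denominator is u^c (1 - u^s) (1 - u^t), of second order in 1 - u like
  the denominator itself. As c is at least 2j, u^c offsets the factor u^j lost in each lower bound
  below, and no dependence on \<open>u\<close> remains.\<close>

lemma quadruple_bound:
  fixes u :: real and c s t j :: nat
  assumes u: "0 < u" "u < 1" and c: "2 * j + 1 \<le> c"
  defines "R \<equiv> (1 - u ^ (c + s)) * (1 - u ^ (c + t)) / ((1 - u ^ c) * (1 - u ^ (c + s + t)))"
  shows "1 \<le> R" "R \<le> 1 + real (s * t) / (real j + 1)^2"
proof -
  have lt1: "u ^ k < 1" if "k > 0" for k using u that by (simp add: power_less_one_iff)
  have le1: "u ^ k \<le> 1" for k using u by (simp add: power_le_one)
  have up: "1 - u ^ k \<le> real k * (1 - u)" for k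
  proof -
    have "1 - u ^ k = (1 - u) * (\<Sum>i<k. u ^ i)" by (rule one_diff_power_eq)
    also have "\<dots> \<le> (1 - u) * (\<Sum>i<k. 1)" using u by (intro mult_left_mono sum_mono le1) simp_all
    finally show ?thesis by (simp add: mult.commute)
  qed
  \<comment> \<open>Only the first j + 1 terms of the geometric sum are kept, each replaced by the
    smallest of them.\<close>
  have low: "(real j + 1) * u ^ j * (1 - u) \<le> 1 - u ^ k" if "c \<le> k" for k
  proof -
    have "(real j + 1) * u ^ j = (\<Sum>i<Suc j. u ^ j)" by simp
    also have "\<dots> \<le> (\<Sum>i<Suc j. u ^ i)" using u by (intro sum_mono power_decreasing) simp_all
    also have "\<dots> \<le> (\<Sum>i<k. u ^ i)" using u that c by (intro sum_mono2) auto
    finally have "(1 - u) * ((real j + 1) * u ^ j) \<le> (1 - u) * (\<Sum>i<k. u ^ i)" using u by (intro mult_left_mono) simp_all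
    also have "\<dots> = 1 - u ^ k" by (rule one_diff_power_eq[symmetric])
    finally show ?thesis by (simp add: mult_ac)
  qed
  define D where "D = (1 - u ^ c) * (1 - u ^ (c + s + t))"
  define w where "w = (real j + 1) * u ^ j * (1 - u)"
  have w: "0 < w" unfolding w_def using u by simp
  have D: "w * w \<le> D" unfolding D_def w_def using u w[unfolded w_def] low[of c] low[of "c + s + t"] by (intro mult_mono) (simp_all add: le1)
  then have D0: "0 < D" using w by (meson less_le_trans mult_pos_pos)
  have "(1 - u ^ (c + s)) * (1 - u ^ (c + t)) = D + u ^ c * ((1 - u ^ s) * (1 - u ^ t))"
    unfolding D_def power_add by algebra
  then have R: "R = 1 + u ^ c * ((1 - u ^ s) * (1 - u ^ t)) / D"
    unfolding R_def D_def[symmetric] using D0 by (simp add: field_simps)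
  show "1 \<le> R" unfolding R using D0 u le1 by simp
  have "u ^ c * ((1 - u ^ s) * (1 - u ^ t)) \<le> (u ^ j * u ^ j) * ((real s * (1 - u)) * (real t * (1 - u)))"
  proof (intro mult_mono up)
    have "u ^ c \<le> u ^ (j + j)" using u c by (intro power_decreasing) simp_all
    then show "u ^ c \<le> u ^ j * u ^ j" by (simp add: power_add)
  qed (use u le1 in simp_all)
  also have "\<dots> = real (s * t) / (real j + 1)^2 * (w * w)"
  proof -
    have "(a * a) * ((S * d) * (T * d)) = S * T / v^2 * ((v * a * d) * (v * a * d))" if "v \<noteq> 0" for a d v S T :: real
      using that by (simp add: field_simps power2_eq_square)
    from this[of "real j + 1" "u ^ j" "real s" "1 - u" "real t"] show ?thesis unfolding w_def by simp
  qed
  finally have "u ^ c * ((1 - u ^ s) * (1 - u ^ t)) / D \<le> real (s * t) / (real j + 1)^2 * (w * w) / D"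
    using D0 by (intro divide_right_mono) simp_all
  also have "\<dots> \<le> real (s * t) / (real j + 1)^2 * D / D"
    using D0 D by (intro divide_right_mono mult_left_mono) simp_all
  also have "\<dots> = real (s * t) / (real j + 1)^2" using D0 by simp
  finally show "R \<le> 1 + real (s * t) / (real j + 1)^2" unfolding R by simp
qed

text \<open>The exponents beyond 6j are 10, 10, 7, 7 above and 12, 12, 9, 1 below, with equal sums.
  Inserting 8 and 3 splits the factor into quotients with balanced pairs: 10 + 10 = 8 + 12, 8 + 7 =
  3 + 12, 3 + 7 = 1 + 9. Their constants 4, 20, 12 add up to 36.\<close>

lemma ln_factor_bound:
  fixes u :: real
  assumes u: "0 < u" "u < 1"
  shows "0 < factor j u" "\<bar>ln (factor j u)\<bar> \<le> 36 / (real j + 1)^2"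
proof -
  define A where "A = (1 - u ^ (6 * j + 10)) * (1 - u ^ (6 * j + 10)) / ((1 - u ^ (6 * j + 8)) * (1 - u ^ (6 * j + 12)))"
  define B where "B = (1 - u ^ (6 * j + 8)) * (1 - u ^ (6 * j + 7)) / ((1 - u ^ (6 * j + 3)) * (1 - u ^ (6 * j + 12)))"
  define C where "C = (1 - u ^ (6 * j + 3)) * (1 - u ^ (6 * j + 7)) / ((1 - u ^ (6 * j + 1)) * (1 - u ^ (6 * j + 9)))"
  have nz: "1 - u ^ k \<noteq> 0" if "k > 0" for k using u that power_less_one_iff[of u k] by simp
  have f: "factor j u = A * B * C"
    unfolding factor_def A_def B_def C_def using nz[of "6 * j + 8"] nz[of "6 * j + 3"] 
    by (simp add: power2_eq_square mult_ac)
  have A: "1 \<le> A" "A \<le> 1 + 4 / (real j + 1)^2"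
    using quadruple_bound[OF u, of j "6 * j + 8" 2 2] unfolding A_def by (simp_all add: ac_simps)
  have B: "1 \<le> B" "B \<le> 1 + 20 / (real j + 1)^2"
    using quadruple_bound[OF u, of j "6 * j + 3" 5 4] unfolding B_def by (simp_all add: ac_simps)
  have C: "1 \<le> C" "C \<le> 1 + 12 / (real j + 1)^2"
  proof -
    have "6 * j + 1 + 2 = 6 * j + 3" "6 * j + 1 + 6 = 6 * j + 7" "6 * j + 3 + 6 = 6 * j + 9" by simp_all
    from quadruple_bound[OF u, of j "6 * j + 1" 2 6, unfolded this, folded C_def]
    show "1 \<le> C" "C \<le> 1 + 12 / (real j + 1)^2" by simp_all
  qed
  show "0 < factor j u" unfolding f using A B C by (intro mult_pos_pos) simp_all
  have "ln (factor j u) = ln A + ln B + ln C" unfolding f using A B C by (simp add: ln_mult)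
  moreover have "ln A \<le> A - 1" "ln B \<le> B - 1" "ln C \<le> C - 1" "0 \<le> ln A" "0 \<le> ln B" "0 \<le> ln C"
    using A B C by (simp_all add: ln_le_minus_one)
  moreover have "36 / (real j + 1)^2 = 4 / (real j + 1)^2 + 20 / (real j + 1)^2 + 12 / (real j + 1)^2" by simp
  ultimately show "\<bar>ln (factor j u)\<bar> \<le> 36 / (real j + 1)^2" using A B C by linarith
qed

lemma limit_factor_pos: "0 < limit_factor j"
  unfolding limit_factor_def by (intro divide_pos_pos mult_pos_pos zero_less_power) simp_all

lemma factor_limit: "(factor j \<longlongrightarrow> limit_factor j) to1"
proof (rule Lim_transform_eventually)
  let ?q = "\<lambda>k (u::real). (1 - u ^ k) / (1 - u)"
  let ?f = "\<lambda>u. (?q (6 * j + 10) u)^2 * (?q (6 * j + 7) u)^2 / ((?q (6 * j + 12) u)^2 * ?q (6 * j + 9) u * ?q (6 * j + 1) u)"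
  have "(?f \<longlongrightarrow> (real (6 * j + 10))^2 * (real (6 * j + 7))^2 / ((real (6 * j + 12))^2 * real (6 * j + 9) * real (6 * j + 1))) to1"
    by (intro tendsto_intros qnumber_limit) simp
  also have "(real (6 * j + 10))^2 * (real (6 * j + 7))^2 / ((real (6 * j + 12))^2 * real (6 * j + 9) * real (6 * j + 1)) = limit_factor j"
    by (simp add: limit_factor_def)
  finally show "(?f \<longlongrightarrow> limit_factor j) to1" .
  show "\<forall>\<^sub>F u in to1. ?f u = factor j u"
  proof (rule eventually_to1)
    fix u :: real assume u: "1/2 < u" "u < 1"
    have "(A / d)^2 * (B / d)^2 / ((C / d)^2 * (D / d) * (E / d)) = A^2 * B^2 / (C^2 * D * E)" if "d \<noteq> 0" for A B C D E d :: real
      using that by (simp add: power_divide power2_eq_square)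
    then show "?f u = factor j u" unfolding factor_def using u by simp
  qed
qed

text \<open>Passing to logarithms makes the infinite product a series, the form in which Tannery's
  theorem applies; partial sums exponentiate to truncated products.\<close>

lemma suminf_ln_factor:
  fixes u :: real
  assumes u: "0 < u" "u < 1"
  shows "exp (\<Sum>j. ln (factor j u)) = product_side u"
proof -
  have lt1: "u ^ k < 1" if "k > 0" for k using u that by (simp add: power_less_one_iff)
  have "summable (\<lambda>j. 36 * (1 / (real (Suc j))^2))"
    using inverse_squares_sums by (intro summable_mult) (simp add: sums_iff)
  then have "summable (\<lambda>j. ln (factor j u))"
    by (rule summable_comparison_test'[where N = 0]) (use ln_factor_bound(2)[OF u] in \<open>simp add: add.commute\<close>)
  then have "(\<lambda>N. exp (\<Sum>j<N. ln (factor j u))) \<longlonglongrightarrow> exp (\<Sum>j. ln (factor j u))"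
    by (intro tendsto_intros summable_LIMSEQ)
  also have "(\<lambda>N. exp (\<Sum>j<N. ln (factor j u))) = (\<lambda>N. (qpoch (u^10) (u^6) N)^2 * (qpoch (u^7) (u^6) N)^2
     / ((qpoch (u^12) (u^6) N)^2 * qpoch (u^9) (u^6) N * qpoch u (u^6) N))"
  proof
    fix N
    have "exp (\<Sum>j<N. ln (factor j u)) = (\<Prod>j<N. factor j u)"
      using ln_factor_bound(1)[OF u] by (simp add: exp_sum)
    also have "\<dots> = (qpoch (u^10) (u^6) N)^2 * (qpoch (u^7) (u^6) N)^2
       / ((qpoch (u^12) (u^6) N)^2 * qpoch (u^9) (u^6) N * qpoch u (u^6) N)"
      unfolding factor_def qpoch_def by (simp add: prod_dividef prod.distrib prod_power_distrib power_add power_mult) (simp add: mult.commute)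
    finally show "exp (\<Sum>j<N. ln (factor j u)) = (qpoch (u^10) (u^6) N)^2 * (qpoch (u^7) (u^6) N)^2
       / ((qpoch (u^12) (u^6) N)^2 * qpoch (u^9) (u^6) N * qpoch u (u^6) N)" .
  qed
  finally have 1: "(\<lambda>N. (qpoch (u^10) (u^6) N)^2 * (qpoch (u^7) (u^6) N)^2
     / ((qpoch (u^12) (u^6) N)^2 * qpoch (u^9) (u^6) N * qpoch u (u^6) N)) \<longlonglongrightarrow> exp (\<Sum>j. ln (factor j u))" .
  have "qpoch_inf (u ^ k) (u^6) \<noteq> 0" if "k > 0" for k
    using qpoch_inf_pos[of "u^6" "u^k"] u lt1 that by simp
  from this[of 12] this[of 9] this[of 1]
  have "(\<lambda>N. (qpoch (u^10) (u^6) N)^2 * (qpoch (u^7) (u^6) N)^2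
     / ((qpoch (u^12) (u^6) N)^2 * qpoch (u^9) (u^6) N * qpoch u (u^6) N)) \<longlonglongrightarrow> product_side u"
    unfolding product_side_def using u lt1[of 6] by (intro tendsto_intros qpoch_LIMSEQ) simp_all
  with 1 show ?thesis by (rule LIMSEQ_unique)
qed

lemma product_side_limit:
  "summable (\<lambda>j. ln (limit_factor j)) \<and> (product_side \<longlongrightarrow> exp (\<Sum>j. ln (limit_factor j))) to1"
proof -
  have "((\<lambda>u. ln (factor j u)) \<longlongrightarrow> ln (limit_factor j)) to1" for j
    using limit_factor_pos[of j] by (intro tendsto_ln factor_limit) simp
  moreover have "\<forall>\<^sub>F (j, u) in at_top \<times>\<^sub>F to1. norm (ln (factor j u)) \<le> 36 / (real j + 1)^2"
  proof -
    have "\<forall>\<^sub>F ju in at_top \<times>\<^sub>F to1. True \<and> (1/2 < snd ju \<and> snd ju < 1)"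
      using eventually_prodI[of "\<lambda>_. True" at_top "\<lambda>u. 1/2 < u \<and> u < 1" to1] eventually_to1[of "\<lambda>u. 1/2 < u \<and> u < 1"] by simp
    then show ?thesis
    proof (rule eventually_mono)
      fix ju :: "nat \<times> real" assume "True \<and> 1/2 < snd ju \<and> snd ju < 1"
      then have "0 < snd ju" "snd ju < 1" by auto
      from ln_factor_bound(2)[OF this, of "fst ju"] 
      show "case ju of (j, u) \<Rightarrow> norm (ln (factor j u)) \<le> 36 / (real j + 1)^2"
        by (simp add: case_prod_beta)
    qed
  qed
  moreover have "summable (\<lambda>j. 36 / (real j + 1)^2)"
    using summable_mult[of "\<lambda>j. 1 / (real (Suc j))^2" 36] inverse_squares_sums by (simp add: sums_iff add.commute)
  ultimately have T: "summable (\<lambda>j. norm (ln (limit_factor j)))"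
     "((\<lambda>u. \<Sum>j. ln (factor j u)) \<longlongrightarrow> (\<Sum>j. ln (limit_factor j))) to1"
    using tannerys_theorem[of "\<lambda>j u. ln (factor j u)" "\<lambda>j. ln (limit_factor j)" to1 "\<lambda>j. 36 / (real j + 1)^2"] by simp_all
  have "\<forall>\<^sub>F u in to1. exp (\<Sum>j. ln (factor j u)) = product_side u"
    by (rule eventually_to1) (simp add: suminf_ln_factor)
  with tendsto_exp[OF T(2)] have "(product_side \<longlongrightarrow> exp (\<Sum>j. ln (limit_factor j))) to1"
    by (rule Lim_transform_eventually)
  with T(1) show ?thesis by (simp add: summable_norm_cancel)
qed

text \<open>With four factors above and four below, the factorials and the powers of 6 cancel. The
  parameter sums 2 + 2 + 3/2 + 1/6 and 5/3 + 5/3 + 7/6 + 7/6 agree, so the powers of N in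
  \<open>Gamma_series'\<close> cancel too.\<close>

lemma limit_product_Gamma:
  "exp (\<Sum>j. ln (limit_factor j)) = Gamma 2 ^ 2 * Gamma (3/2) * Gamma (1/6) / (Gamma (5/3) ^ 2 * Gamma (7/6) ^ 2)"
proof -
  let ?G = "\<lambda>N. Gamma_series' (2::real) N ^ 2 * Gamma_series' (3/2) N * Gamma_series' (1/6) N
      / (Gamma_series' (5/3) N ^ 2 * Gamma_series' (7/6) N ^ 2)"
  have "(\<lambda>N. exp (\<Sum>j<N. ln (limit_factor j))) \<longlonglongrightarrow> exp (\<Sum>j. ln (limit_factor j))"
    using product_side_limit by (intro tendsto_intros summable_LIMSEQ) simp
  moreover have "\<forall>\<^sub>F N in sequentially. exp (\<Sum>j<N. ln (limit_factor j)) = ?G N"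
    using eventually_gt_at_top[of 0]
  proof eventually_elim
    fix N :: nat assume N: "0 < N"
    have "exp (\<Sum>j<N. ln (limit_factor j)) = (\<Prod>j<N. limit_factor j)"
      using limit_factor_pos by (simp add: exp_sum)
    also have "\<dots> = (\<Prod>j<N. 6 * real j + 10)^2 * (\<Prod>j<N. 6 * real j + 7)^2
       / ((\<Prod>j<N. 6 * real j + 12)^2 * (\<Prod>j<N. 6 * real j + 9) * (\<Prod>j<N. 6 * real j + 1))"
      unfolding limit_factor_def by (simp add: prod_dividef prod.distrib prod_power_distrib)
    also have "\<dots> = pochhammer (5/3) N ^ 2 * pochhammer (7/6) N ^ 2
       / (pochhammer 2 N ^ 2 * pochhammer (3/2) N * pochhammer (1/6) N)"
      by (simp add: prod_arith_pochhammer power_mult_distrib power2_eq_square)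
    also have "\<dots> = ?G N"
    proof -
      define g l where "g = (fact (N - 1) :: real)" and "l = ln (real N)"
      have G: "Gamma_series' z N = g * exp (z * l) / pochhammer z N" for z :: real
        by (simp add: Gamma_series'_def g_def l_def)
      have pos: "pochhammer z N \<noteq> 0" if "0 < z" for z :: real using pochhammer_pos[OF that, of N] by simp
      have ex: "exp (2 * l) ^ 2 * exp (3/2 * l) * exp (1/6 * l) = exp (5/3 * l) ^ 2 * exp (7/6 * l) ^ 2"
        by (simp add: power2_eq_square flip: exp_add)
      have "?G N = g^4 * (exp (2 * l) ^ 2 * exp (3/2 * l) * exp (1/6 * l)) / (pochhammer 2 N ^ 2 * pochhammer (3/2) N * pochhammer (1/6) N)
        / (g^4 * (exp (5/3 * l) ^ 2 * exp (7/6 * l) ^ 2) / (pochhammer (5/3) N ^ 2 * pochhammer (7/6) N ^ 2))"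
        unfolding G by (simp add: power_mult_distrib power_divide eval_nat_numeral mult_ac)
      also have "\<dots> = pochhammer (5/3) N ^ 2 * pochhammer (7/6) N ^ 2
       / (pochhammer 2 N ^ 2 * pochhammer (3/2) N * pochhammer (1/6) N)"
        unfolding ex by (simp add: g_def)
      finally show ?thesis by (rule sym)
    qed
    finally show "exp (\<Sum>j<N. ln (limit_factor j)) = ?G N" .
  qed
  ultimately have "?G \<longlonglongrightarrow> exp (\<Sum>j. ln (limit_factor j))" by (rule Lim_transform_eventually)
  moreover have "Gamma (5/3::real) \<noteq> 0" "Gamma (7/6::real) \<noteq> 0"
    by (simp_all add: less_imp_neq[OF Gamma_real_pos, symmetric])
  then have "?G \<longlonglongrightarrow> Gamma 2 ^ 2 * Gamma (3/2) * Gamma (1/6) / (Gamma (5/3) ^ 2 * Gamma (7/6) ^ 2)"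
    by (intro tendsto_intros Gamma_series'_LIMSEQ) simp
  ultimately show ?thesis by (rule LIMSEQ_unique)
qed

text \<open>Up to elementary factors the left side is 1 / (Gamma(1/6) Gamma(2/3)^2). Duplication at
  1/6 turns Gamma(1/6) Gamma(2/3) into a multiple of Gamma(1/3), and reflection at 1/3 absorbs the
  remaining Gamma(2/3).\<close>

lemma Gamma_value:
  "Gamma 2 ^ 2 * Gamma (3/2) * Gamma (1/6) / (Gamma (5/3) ^ 2 * Gamma (7/6) ^ 2) = 7 * (81 * sqrt 3 / (28 * 2 powr (2/3) * pi))"
proof -
  have G2: "Gamma (2::real) = 1" using Gamma_fact[of 1, where 'a = real] by simp
  have np: "z \<notin> \<int>\<^sub>\<le>\<^sub>0" if "0 < z" for z :: real using that by (auto elim!: nonpos_Ints_cases)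
  have G32: "Gamma (3/2::real) = sqrt pi / 2" using Gamma_plus1[OF np[of "1/2"]] by (simp add: Gamma_one_half_real)
  have G53: "Gamma (5/3::real) = 2/3 * Gamma (2/3)" using Gamma_plus1[OF np[of "2/3"]] by simp
  have G76: "Gamma (7/6::real) = 1/6 * Gamma (1/6)" using Gamma_plus1[OF np[of "1/6"]] by simp
  have refl: "Gamma (1/3::real) * Gamma (2/3) = 2 * pi / sqrt 3"
  proof -
    have "complex_of_real (Gamma (1/3) * Gamma (2/3)) = Gamma (of_real (1/3)) * Gamma (1 - of_real (1/3))"
      by (simp flip: Gamma_complex_of_real of_real_diff)
    also have "\<dots> = of_real pi / sin (of_real pi * of_real (1/3))" by (rule Gamma_reflection_complex)
    also have "\<dots> = of_real (pi / sin (pi / 3))" by (simp flip: sin_of_real)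
    finally have "Gamma (1/3) * Gamma (2/3) = pi / sin (pi / 3)" by (simp only: of_real_eq_iff)
    then show ?thesis by (simp add: sin_60)
  qed
  have dup: "Gamma (1/6::real) * Gamma (2/3) = 2 powr (2/3) * sqrt pi * Gamma (1/3)"
  proof -
    have "complex_of_real (Gamma (1/6) * Gamma (2/3)) = Gamma (of_real (1/6)) * Gamma (of_real (1/6) + 1/2)"
      by (simp flip: Gamma_complex_of_real)
    also have "\<dots> = exp ((1 - 2 * of_real (1/6)) * of_real (ln 2)) * of_real (sqrt pi) * Gamma (2 * of_real (1/6))"
      by (rule Gamma_legendre_duplication) (auto elim!: nonpos_Ints_cases simp: complex_eq_iff)
    also have "\<dots> = of_real (exp (2/3 * ln 2) * sqrt pi * Gamma (1/3))"
      by (simp flip: Gamma_complex_of_real exp_of_real)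
    finally have "Gamma (1/6) * Gamma (2/3) = exp (2/3 * ln 2) * sqrt pi * Gamma (1/3)" by (simp only: of_real_eq_iff)
    then show ?thesis by (simp add: powr_def)
  qed
  define x y z where "x = Gamma (1/6::real)" and "y = Gamma (2/3::real)" and "z = Gamma (1/3::real)"
  have pos: "0 < x" "0 < y" "0 < z" unfolding x_def y_def z_def by (auto intro: Gamma_real_pos)
  define r t where "r = sqrt pi" and "t = (2::real) powr (2/3)"
  have rt: "0 < r" "0 < t" by (simp_all add: r_def t_def)
  have D: "x * y = t * r * z" and R: "z * y = 2 * pi / sqrt 3"
    using dup refl by (simp_all add: x_def y_def z_def r_def t_def)
  have "1^2 * (r / 2) * x / ((2/3 * y)^2 * (1/6 * x)^2) = 81 / 2 * r / ((x * y) * y)"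
    using pos by (simp add: field_simps power2_eq_square)
  also have "\<dots> = 81 / 2 / (t * (z * y))" unfolding D using rt pos by (simp add: field_simps)
  also have "\<dots> = 81 * sqrt 3 / (4 * t * pi)" unfolding R by simp
  finally show ?thesis unfolding G2 G32 G53 G76 x_def[symmetric] y_def[symmetric] r_def[symmetric] t_def[symmetric] by simp
qed

lemma sixth_root_powers:
  fixes q :: real
  assumes q: "0 < q" "q < 1"
  defines "u \<equiv> q powr (1/6)"
  shows "0 < u" "u < 1" "r = real k / 6 \<Longrightarrow> q powr r = u ^ k" "q powr (-1/6) = 1 / u" "q = u ^ 6"
proof -
  show "0 < u" "u < 1" unfolding u_def using q powr_less_mono2[of "1/6" q 1] by simp_all
  show pw: "q powr r = u ^ k" if "r = real k / 6" for k r
    unfolding that u_def using q by (simp add: powr_powr flip: powr_realpow)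
  show "q powr (-1/6) = 1 / u" unfolding u_def using q by (simp add: powr_minus_divide)
  show "q = u ^ 6" using pw[of 1 6] q by simp
qed

theorem mainTheorem11:
  shows "(\<forall>q::real. 0 < q \<and> q < 1 \<longrightarrow>
    (\<lambda>n::nat.
        (-1) ^ n
        * ((qpoch (q powr (2/3)) (q powr (1/2)) n * qpoch (q powr (5/6)) (q powr (1/2)) n
             * qpoch (q powr (7/6)) (q powr (1/2)) n)
           * qpoch (q powr (-1/6)) q n * qpoch (q powr (2/3)) q n
           / (qpoch q q n * qpoch (q ^ 2) q n
             * qpoch (q powr (3/2)) (q powr (1/2)) (3 * n) * (1 + q powr (1/3))))
        * q powr (real n * (9 * real n + 11) / 12)
        * ((1 + q powr (real n / 2 + 1/6)) * (1 + q powr (real n / 2 + 1/3))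
             * (1 + q powr (real n / 2 + 1/2)) * (1 + q powr (real n + 1/3))
           - q powr ((real n + 1) / 2) * (1 + q powr (3/2 * real n + 1/3))))
    sums
      ((qpoch_inf (q powr (5/3)) q) ^ 2 * (qpoch_inf (q powr (7/6)) q) ^ 2
        / ((qpoch_inf (q ^ 2) q) ^ 2 * qpoch_inf (q powr (3/2)) q * qpoch_inf (q powr (1/6)) q)))
  \<and>
    (\<lambda>n::nat.
        (-1 / 27 :: real) ^ n
        * (pochhammer (2/3) n * pochhammer (7/3) n * pochhammer (-1/6) n
           / (pochhammer 1 n * pochhammer 1 n * pochhammer 2 n)))
    sums
      (81 * sqrt 3 / (28 * 2 powr (2/3) * pi))"
proof (intro conjI allI impI)
  fix q :: real assume "0 < q \<and> q < 1"
  then have "0 < q" "q < 1" by auto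
  define u where "u = q powr (1/6)"
  note root = sixth_root_powers[OF \<open>0 < q\<close> \<open>q < 1\<close>, folded u_def]
  note u = root(1,2) and pw = root(3) and pw' = root(4) and q = root(5)
  have e: "q powr (1/3) = u^2" "q powr (1/2) = u^3" "q powr (2/3) = u^4" "q powr (5/6) = u^5" "q powr (7/6) = u^7"
    "q powr (3/2) = u^9" "q powr (5/3) = u^10"
    by (rule pw, simp)+
  have e': "q powr (1/6) = u" by (simp add: u_def)
  have e'': "q ^ 2 = u ^ 12" by (subst q) (simp flip: power_mult)
  have f: "q powr (real n * (9 * real n + 11) / 12) = u ^ (n * (9 * n + 11) div 2)" for n
  proof (rule pw)
    have "even (n * (9 * n + 11))" by simp
    then have "real (n * (9 * n + 11) div 2) = real (n * (9 * n + 11)) / 2" by (simp add: real_of_nat_div)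
    then show "real n * (9 * real n + 11) / 12 = real (n * (9 * n + 11) div 2) / 6" by simp
  qed
  have g: "q powr (real n / 2 + 1/6) = u ^ (3 * n + 1)" "q powr (real n / 2 + 1/3) = u ^ (3 * n + 2)"
    "q powr (real n / 2 + 1/2) = u ^ (3 * n + 3)" "q powr (real n + 1/3) = u ^ (6 * n + 2)"
    "q powr ((real n + 1) / 2) = u ^ (3 * n + 3)" "q powr (3/2 * real n + 1/3) = u ^ (9 * n + 2)" for n
    by (rule pw, simp add: field_simps)+
  have series: "core u n * bracket u n / (1 + u^2) = (-1) ^ n
        * ((qpoch (u^4) (u^3) n * qpoch (u^5) (u^3) n * qpoch (u^7) (u^3) n)
           * qpoch (1 / u) (u^6) n * qpoch (u^4) (u^6) n
           / (qpoch (u^6) (u^6) n * qpoch (u^12) (u^6) n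
             * qpoch (u^9) (u^3) (3 * n) * (1 + u^2)))
        * u ^ (n * (9 * n + 11) div 2)
        * ((1 + u ^ (3 * n + 1)) * (1 + u ^ (3 * n + 2)) * (1 + u ^ (3 * n + 3)) * (1 + u ^ (6 * n + 2))
           - u ^ (3 * n + 3) * (1 + u ^ (9 * n + 2)))" for n
    unfolding core_def bracket_def[symmetric] by simp
  show "(\<lambda>n::nat.
        (-1) ^ n
        * ((qpoch (q powr (2/3)) (q powr (1/2)) n * qpoch (q powr (5/6)) (q powr (1/2)) n
             * qpoch (q powr (7/6)) (q powr (1/2)) n)
           * qpoch (q powr (-1/6)) q n * qpoch (q powr (2/3)) q n
           / (qpoch q q n * qpoch (q ^ 2) q n
             * qpoch (q powr (3/2)) (q powr (1/2)) (3 * n) * (1 + q powr (1/3))))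
        * q powr (real n * (9 * real n + 11) / 12)
        * ((1 + q powr (real n / 2 + 1/6)) * (1 + q powr (real n / 2 + 1/3))
             * (1 + q powr (real n / 2 + 1/2)) * (1 + q powr (real n + 1/3))
           - q powr ((real n + 1) / 2) * (1 + q powr (3/2 * real n + 1/3))))
    sums
      ((qpoch_inf (q powr (5/3)) q) ^ 2 * (qpoch_inf (q powr (7/6)) q) ^ 2
        / ((qpoch_inf (q ^ 2) q) ^ 2 * qpoch_inf (q powr (3/2)) q * qpoch_inf (q powr (1/6)) q))"
    unfolding e e' e'' f g pw' using sums_product_side[OF u]
    unfolding series product_side_def q[symmetric] .
next
  \<comment> \<open>Both sides are limits of \<open>product_side\<close> at 1 from the left, once
    through the series and once through the product.\<close>
  have "(\<Sum>n. 7 * limit_term n) = exp (\<Sum>j. ln (limit_factor j))"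
    using series_limit product_side_limit by (intro tendsto_unique[of to1 product_side]) simp_all
  then have "(\<Sum>n. 7 * limit_term n) = 7 * (81 * sqrt 3 / (28 * 2 powr (2/3) * pi))"
    unfolding limit_product_Gamma Gamma_value .
  moreover have "summable (\<lambda>n. 7 * limit_term n)" by (rule summable_norm_cancel[OF conjunct1[OF series_limit]])
  ultimately have "(\<lambda>n. 7 * limit_term n) sums (7 * (81 * sqrt 3 / (28 * 2 powr (2/3) * pi)))"
    by (simp only: sums_iff simp_thms)
  from sums_mult[OF this, of "1/7"] have "limit_term sums (81 * sqrt 3 / (28 * 2 powr (2/3) * pi))"
    by (simp add: mult_ac)
  then show "(\<lambda>n::nat.
        (-1 / 27 :: real) ^ n
        * (pochhammer (2/3) n * pochhammer (7/3) n * pochhammer (-1/6) n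
           / (pochhammer 1 n * pochhammer 1 n * pochhammer 2 n)))
    sums
      (81 * sqrt 3 / (28 * 2 powr (2/3) * pi))"
    unfolding limit_term_def .
qed

end
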